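(* Let $k\in(0,1)$, $k'=\sqrt{1-k^2}$, $K=K(k)$ and $K'=K(k')$. Then for every $u\in\mathbb{C}$ satisfying $|\operatorname{Re}(u)|<K$ and $|\operatorname{Im}(u)|<K'$ we have $$\frac{1}{2}\int_{\mathbb{R}} \frac{\sin(\sqrt{x}\,u)}{\sqrt{x}}\cdot\frac{dx}{\cos(\sqrt{x}K)+\cosh(\sqrt{x}K')}=\frac{\operatorname{sn}(u,k)}{\operatorname{cd}(u,k)}.$$
   Context: For $k\in(0,1)$, $K(k)=\frac{\pi}{2}\,{}_2F_1(\tfrac12,\tfrac12;1;k^2)=\int_0^{\pi/2}\frac{d\theta}{\sqrt{1-k^2\sin^2\theta}}$ is the complete elliptic integral of the first kind with modulus $k$. $\operatorname{sn}(u,k),\operatorname{cn}(u,k),\operatorname{dn}(u,k)$ are the Jacobi elliptic functions with modulus $k$: the meromorphic functions of $u\in\mathbb{C}$ determined by $\operatorname{sn}'=\operatorname{cn}\operatorname{dn}$, $\operatorname{cn}'=-\operatorname{sn}\operatorname{dn}$, $\operatorname{dn}'=-k^2\operatorname{sn}\operatorname{cn}$, with $\operatorname{sn}(0,k)=0$, $\operatorname{cn}(0,k)=\operatorname{dn}(0,k)=1$. Moreover $\operatorname{cd}(u,k)=\operatorname{cn}(u,k)/\operatorname{dn}(u,k)$. The integral runs over the whole real line. For $x<0$, $\sqrt{x}=i\sqrt{|x|}$ (all functions of $\sqrt{x}$ appearing in the integrand are even in $\sqrt{x}$, so the choice of square root is irrelevant). At $x=0$, $\sin(\sqrt{x}u)/\sqrt{x}$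 is understood as $u$. *)

theory Defs
  imports "HOL-Complex_Analysis.Complex_Analysis"
begin

definition elliptic_K :: "real \<Rightarrow> real" where
  "elliptic_K k = integral {0..pi/2} (\<lambda>\<theta>. 1 / sqrt (1 - k\<^sup>2 * (sin \<theta>)\<^sup>2))"

(* Meromorphic functions are total functions here. The requirement of being nicely meromorphic
   removes all removable singularities and fixes the value 0 at each pole, so that the initial
   value problem has at most one solution as a triple of total functions. The differential
   equations are meaningful, and imposed, exactly where none of the three functions has a pole;
   0 is explicitly required to be such a point, as the value 0 of sn at 0 alone would not say so. *)
definition is_jacobi_triple ::
  "real \<Rightarrow> (complex \<Rightarrow> complex) \<Rightarrow> (complex \<Rightarrow> complex) \<Rightarrow> (complex \<Rightarrow> complex) \<Rightarrow> bool" where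
  "is_jacobi_triple k s c d \<longleftrightarrow>
     s nicely_meromorphic_on UNIV \<and> c nicely_meromorphic_on UNIV \<and> d nicely_meromorphic_on UNIV \<and>
     (\<forall>u. \<not> is_pole s u \<and> \<not> is_pole c u \<and> \<not> is_pole d u \<longrightarrow>
        (s has_field_derivative c u * d u) (at u) \<and>
        (c has_field_derivative - (s u * d u)) (at u) \<and>
        (d has_field_derivative - ((of_real k)\<^sup>2 * s u * c u)) (at u)) \<and>
     \<not> is_pole s 0 \<and> \<not> is_pole c 0 \<and> \<not> is_pole d 0 \<and>
     s 0 = 0 \<and> c 0 = 1 \<and> d 0 = 1"

definition jacobi_triple ::
  "real \<Rightarrow> (complex \<Rightarrow> complex) \<times> (complex \<Rightarrow> complex) \<times> (complex \<Rightarrow> complex)" where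
  "jacobi_triple k = (THE (s, c, d). is_jacobi_triple k s c d)"

definition jacobi_sn :: "complex \<Rightarrow> real \<Rightarrow> complex" where
  "jacobi_sn u k = fst (jacobi_triple k) u"

definition jacobi_cn :: "complex \<Rightarrow> real \<Rightarrow> complex" where
  "jacobi_cn u k = fst (snd (jacobi_triple k)) u"

definition jacobi_dn :: "complex \<Rightarrow> real \<Rightarrow> complex" where
  "jacobi_dn u k = snd (snd (jacobi_triple k)) u"

definition jacobi_cd :: "complex \<Rightarrow> real \<Rightarrow> complex" where
  "jacobi_cd u k = jacobi_cn u k / jacobi_dn u k"

(* csqrt (of_real x) = i * sqrt |x| for x < 0 *)
definition sin_sqrt_quot :: "complex \<Rightarrow> real \<Rightarrow> complex" where
  "sin_sqrt_quot u x = (if x = 0 then u else sin (csqrt (of_real x) * u) / csqrt (of_real x))"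

end

theory Submission
  imports Defs "HOL-Real_Asymp.Real_Asymp"
begin

text \<open>Let \<open>G = sn / cd = sn dn / cn = - (log cn)'\<close>. It is odd and elliptic with periods \<open>2 K\<close> and
  \<open>2 \<i> K'\<close>, with simple poles exactly at the points \<open>n K + \<i> m K'\<close>, \<open>n + m\<close> odd, and residues
  \<open>(-1)\<^sup>n\<close>. Integrating \<open>G w (1 / (w - u) - 1 / (w + u))\<close> over growing rectangles expresses \<open>G u\<close>
  as the limit of the sums of \<open>(-1)\<^sup>n / (u - n K - \<i> m K')\<close> over the squares \<open>\<bar>n\<bar>, \<bar>m\<bar> \<le> N\<close>.

  On the other side, with \<open>z = \<surd>x\<close>, \<open>a = - exp (z (- K' + \<i> K))\<close> and \<open>b = - exp (z (- K' - \<i> K))\<close>,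
  \<open>1 / (cos (z K) + cosh (z K')) = 2 exp (- z K') / ((1 - a) (1 - b))\<close>; expanding this as a double
  geometric series and integrating termwise turns the integral over \<open>x > 0\<close> into the part of the
  above sum with \<open>\<bar>m\<bar> > \<bar>n\<bar>\<close>. The substitution \<open>u \<mapsto> \<i> u\<close>, \<open>K \<leftrightarrow> K'\<close> turns the integral over
  \<open>x < 0\<close> into the part with \<open>\<bar>n\<bar> > \<bar>m\<bar>\<close>.

  The Jacobi functions on \<open>\<complex>\<close> are obtained from the real ones (for \<open>k\<close> and \<open>k'\<close>), which come from
  inverting the incomplete elliptic integral.\<close>

section \<open>Jacobi elliptic functions on the real line\<close>

text \<open>After pairing p with -p the summand decays only like |p|^-2, so the double series over
  the lattice is not absolutely convergent and its value may depend on the order of summation. Hence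
  both sides must be truncated in the same way: collecting the double geometric series by total
  degree and stopping after M degrees gives exactly the points of the square of size M in one pair
  of opposite cones, which is what the contour argument sees. For the same reason the termwise
  integration cannot rest on absolute summability. Near z = 0 the moduli of the terms add up to
  order z^-2, whereas the alternating signs keep the partial sums at order 1/z, and the zero of the
  sine absorbs that. The Jacobi functions are given by a definite description, so a global
  meromorphic triple and its uniqueness are both required, including the value 0 at poles. Quotients
  over one common real-valued denominator serve this purpose: its zeros are explicit, and division
  by 0 yields the prescribed value.\<close>

definition real_jacobi :: "real \<Rightarrow> real \<Rightarrow> (real \<Rightarrow> real) \<Rightarrow> (real \<Rightarrow> real) \<Rightarrow> (real \<Rightarrow> real) \<Rightarrow> bool" where
  "real_jacobi k K s c d \<longleftrightarrow> 0 < k \<and> k < 1 \<and> 0 < K \<and>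
     (\<forall>x. (s has_real_derivative c x * d x) (at x)) \<and>
     (\<forall>x. (c has_real_derivative - (s x * d x)) (at x)) \<and>
     (\<forall>x. (d has_real_derivative - (k\<^sup>2 * s x * c x)) (at x)) \<and>
     (\<forall>x. (c x)\<^sup>2 = 1 - (s x)\<^sup>2 \<and> (d x)\<^sup>2 = 1 - k\<^sup>2 * (s x)\<^sup>2 \<and> 0 < d x) \<and>
     s 0 = 0 \<and> c 0 = 1 \<and> d 0 = 1 \<and>
     (\<forall>x. s (x + 2 * K) = - s x \<and> c (x + 2 * K) = - c x \<and> d (x + 2 * K) = d x) \<and>
     (\<forall>x. s (- x) = - s x \<and> c (- x) = c x \<and> d (- x) = d x) \<and>
     (\<forall>x. s x = 0 \<longleftrightarrow> (\<exists>n::int. x = 2 * of_int n * K)) \<and>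
     (\<forall>x. c x = 0 \<longleftrightarrow> (\<exists>n::int. x = (2 * of_int n + 1) * K))"

lemma antiderivative_exists:
  fixes h :: "real \<Rightarrow> real"
  assumes "continuous_on UNIV h"
  obtains F where "\<And>x. (F has_real_derivative h x) (at x)" "F 0 = 0"
proof -
  have "\<exists>F. \<forall>x. (-\<infinity>::ereal) < ereal x \<longrightarrow> ereal x < \<infinity> \<longrightarrow> (F has_vector_derivative h x) (at x)"
    by (rule einterval_antiderivative) (use assms in \<open>auto simp: continuous_on_eq_continuous_at\<close>)
  then obtain F where F: "\<And>x. (F has_real_derivative h x) (at x)"
    by (auto simp: has_real_derivative_iff_has_vector_derivative)
  have "((\<lambda>x. F x - F 0) has_real_derivative h x) (at x)" for x
    using F[of x] by (auto intro!: derivative_eq_intros)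
  then show ?thesis by (rule that) simp
qed

text \<open>The amplitude \<open>am\<close> is the inverse of the incomplete integral
  \<open>F\<close>; sn, cn and dn are sin, cos and \<open>\<Delta>\<close> composed with it. Parity,
  periods and zeros carry over from sin and cos through \<open>F (- x) = - F x\<close> and
  \<open>F (x + pi) = F x + 2 * K\<close>.\<close>

lemma real_jacobi_exists:
  assumes k: "0 < k" "k < 1"
  obtains s c d where "real_jacobi k (elliptic_K k) s c d"
proof -
  define \<Delta> where "\<Delta> = (\<lambda>\<theta>::real. sqrt (1 - k\<^sup>2 * (sin \<theta>)\<^sup>2))"
  have k2: "k\<^sup>2 < 1" using k by (simp add: power_less_one_iff)
  have pos: "0 < 1 - k\<^sup>2 * (sin \<theta>)\<^sup>2" for \<theta>
  proof -
    have "k\<^sup>2 * (sin \<theta>)\<^sup>2 \<le> k\<^sup>2 * 1"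
      by (intro mult_left_mono) (auto simp: abs_square_le_1)
    with k2 show ?thesis by simp
  qed
  have D_pos: "0 < \<Delta> \<theta>" for \<theta> using pos by (simp add: \<Delta>_def)
  have D_le: "\<Delta> \<theta> \<le> 1" for \<theta> by (simp add: \<Delta>_def)
  have D_sq: "(\<Delta> \<theta>)\<^sup>2 = 1 - k\<^sup>2 * (sin \<theta>)\<^sup>2" for \<theta> using pos[of \<theta>] by (simp add: \<Delta>_def)
  have "continuous_on UNIV (\<lambda>\<theta>. 1 / \<Delta> \<theta>)"
    using D_pos by (auto intro!: continuous_intros simp: \<Delta>_def less_imp_neq[symmetric] )
  then obtain F where F: "\<And>x. (F has_real_derivative 1 / \<Delta> x) (at x)" and F0: "F 0 = 0"
    using antiderivative_exists by blast
  have F_cont: "isCont F x" for x using F[of x] DERIV_isCont by blast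
  \<comment> \<open>The integrand is at least 1, so \<open>F\<close> grows at least linearly. This
    gives injectivity and, with the intermediate value theorem, surjectivity.\<close>
  have F_diff: "y - x \<le> F y - F x" if "x \<le> y" for x y
  proof -
    have "F x - x \<le> F y - y"
    proof (rule DERIV_nonneg_imp_nondecreasing[OF that])
      fix z
      have "((\<lambda>x. F x - x) has_real_derivative 1 / \<Delta> z - 1) (at z)"
        using F[of z] by (auto intro!: derivative_eq_intros)
      moreover have "0 \<le> 1 / \<Delta> z - 1" using D_pos[of z] D_le[of z] by (simp add: field_simps)
      ultimately show "\<exists>w. ((\<lambda>x. F x - x) has_real_derivative w) (at z) \<and> 0 \<le> w" by blast
    qed
    then show ?thesis by simp
  qed
  have F_mono: "strict_mono F"
    by (rule strict_monoI) (use F_diff in \<open>smt (verit)\<close>)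
  then have F_inj: "inj F" by (rule strict_mono_imp_inj_on)
  have F_surj: "surj F"
  proof -
    have "\<exists>x. F x = y" for y
    proof -
      have "\<exists>x. -\<bar>y\<bar> \<le> x \<and> x \<le> \<bar>y\<bar> \<and> F x = y"
        by (rule IVT) (use F_diff[of 0 "\<bar>y\<bar>"] F_diff[of "-\<bar>y\<bar>" 0] F0 F_cont in auto)
      then show ?thesis by blast
    qed
    then show ?thesis by (metis surjI)
  qed
  define K where "K = F (pi/2)"
  have "((\<lambda>\<theta>. 1 / \<Delta> \<theta>) has_integral (F (pi/2) - F 0)) {0..pi/2}"
    by (rule fundamental_theorem_of_calculus)
      (auto simp: has_real_derivative_iff_has_vector_derivative[symmetric] intro!: DERIV_subset[OF F])
  then have K_eq: "elliptic_K k = K"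
    unfolding elliptic_K_def K_def F0 \<Delta>_def by (simp add: integral_unique)
  have K_pos: "0 < K" using F_mono F0 unfolding K_def by (metis pi_half_gt_zero strict_mono_less)
  have F_minus: "F (- x) = - F x" for x
  proof -
    have "((\<lambda>x. F (- x) + F x) has_real_derivative 0) (at x)" for x
      by (rule derivative_eq_intros F DERIV_chain2[OF F] refl)+ (simp add: \<Delta>_def)
    then have "F (- x) + F x = F (- 0) + F 0" using DERIV_isconst_all[of "\<lambda>x. F (- x) + F x"] by blast
    then show ?thesis using F0 by simp
  qed
  have F_shift: "F (x + pi) = F x + 2 * K" for x
  proof -
    have "((\<lambda>x. F (x + pi) - F x) has_real_derivative 0) (at x)" for x
      by (rule derivative_eq_intros F DERIV_chain2[OF F] refl)+ (simp add: \<Delta>_def)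
    \<comment> \<open>The constant is evaluated at -pi/2, where oddness turns it into 2
      F(pi/2).\<close>
    then have "F (x + pi) - F x = F (- (pi/2) + pi) - F (- (pi/2))"
      using DERIV_isconst_all[of "\<lambda>x. F (x + pi) - F x"] by blast
    then show ?thesis unfolding F_minus by (simp add: K_def)
  qed
  define am where "am = inv F"
  have am_F: "am (F x) = x" for x by (simp add: am_def F_inj)
  have F_am: "F (am x) = x" for x by (simp add: am_def F_surj surj_f_inv_f)
  have am_eq: "am x = y \<longleftrightarrow> x = F y" for x y using am_F F_am by metis
  have am_minus: "am (- x) = - am x" for x by (simp add: am_eq F_minus F_am)
  have am_shift: "am (x + 2 * K) = am x + pi" for x by (simp add: am_eq F_shift F_am)
  have F_npi: "F (x + of_int n * pi) = F x + 2 * of_int n * K" for x and n :: int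
  proof (induction n rule: int_induct[where k = 0])
    case (step1 i) then show ?case using F_shift[of "x + of_int i * pi"] by (simp add: algebra_simps)
  next
    case (step2 i) then show ?case using F_shift[of "x + of_int (i - 1) * pi"] by (simp add: algebra_simps)
  qed simp
  have am_cont: "isCont am x" for x
    using isCont_inverse_function[of 1 "am x" am F] am_F F_cont F_am by simp
  have am_deriv: "(am has_real_derivative \<Delta> (am x)) (at x)" for x
    using DERIV_inverse_function[where f = F and g = am and x = x and D = "1 / \<Delta> (am x)" and a = "x - 1" and b = "x + 1"]
      F[of "am x"] D_pos[of "am x"] F_am am_cont by simp
  note am_deriv' = DERIV_chain2[OF _ am_deriv]
  define s where "s = (\<lambda>x. sin (am x))"
  define c where "c = (\<lambda>x. cos (am x))"
  define d where "d = (\<lambda>x. \<Delta> (am x))"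
  have 1: "(s has_real_derivative c x * d x) (at x)" for x
    unfolding s_def c_def d_def by (rule am_deriv') (rule DERIV_sin)
  have 2: "(c has_real_derivative - (s x * d x)) (at x)" for x
    unfolding s_def c_def d_def using am_deriv'[OF DERIV_cos, of x] by simp
  have 3: "(d has_real_derivative - (k\<^sup>2 * s x * c x)) (at x)" for x
  proof -
    have "(\<Delta> has_real_derivative - (k\<^sup>2 * sin \<theta> * cos \<theta>) / \<Delta> \<theta>) (at \<theta>)" for \<theta>
    proof -
      have "((\<lambda>\<theta>. 1 - k\<^sup>2 * (sin \<theta>)\<^sup>2) has_real_derivative - (2 * k\<^sup>2 * sin \<theta> * cos \<theta>)) (at \<theta>)"
        by (auto intro!: derivative_eq_intros)
      from DERIV_chain2[OF DERIV_real_sqrt[OF pos] this] show ?thesis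
        unfolding \<Delta>_def using pos[of \<theta>] by (simp add: field_simps)
    qed
    from am_deriv'[OF this, of x] show ?thesis
      using D_pos[of "am x"] by (simp add: d_def s_def c_def)
  qed
  have 4: "(c x)\<^sup>2 = 1 - (s x)\<^sup>2 \<and> (d x)\<^sup>2 = 1 - k\<^sup>2 * (s x)\<^sup>2 \<and> 0 < d x" for x
    using D_pos D_sq by (simp add: s_def c_def d_def cos_squared_eq)
  have 5: "s 0 = 0 \<and> c 0 = 1 \<and> d 0 = 1"
    using am_F[of 0] by (simp add: F0 s_def c_def d_def \<Delta>_def)
  have 6: "s (x + 2 * K) = - s x \<and> c (x + 2 * K) = - c x \<and> d (x + 2 * K) = d x" for x
    by (simp add: s_def c_def d_def \<Delta>_def am_shift)
  have 7: "s (- x) = - s x \<and> c (- x) = c x \<and> d (- x) = d x" for x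
    by (simp add: s_def c_def d_def \<Delta>_def am_minus)
  have 8: "s x = 0 \<longleftrightarrow> (\<exists>n::int. x = 2 * of_int n * K)" for x
    using F_npi[of 0] by (simp add: s_def sin_zero_iff_int2 am_eq F0)
  have 9: "c x = 0 \<longleftrightarrow> (\<exists>n::int. x = (2 * of_int n + 1) * K)" for x
    using F_npi[of "pi/2"] by (simp add: c_def cos_zero_iff_int2 am_eq K_def[symmetric] algebra_simps)
  show ?thesis
    by (rule that[of s c d], unfold K_eq real_jacobi_def) (use k K_pos 1 2 3 4 5 6 7 8 9 in blast)
qed

section \<open>Jacobi elliptic functions on the complex plane\<close>

text \<open>Numerator and denominator are only real differentiable, with partial derivatives A, B
  and A', B'. The last two hypotheses say that the quotient has partial derivatives F and i F, which
  are the Cauchy-Riemann equations.\<close>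

lemma field_derivative_divide_from_partials:
  fixes N W :: "complex \<Rightarrow> complex"
  assumes N: "(N has_derivative (\<lambda>h. of_real (Re h) * A + of_real (Im h) * B)) (at z)"
    and W: "(W has_derivative (\<lambda>h. of_real (Re h) * A' + of_real (Im h) * B')) (at z)"
    and "W z \<noteq> 0"
    and x: "A * W z - N z * A' = F * (W z)\<^sup>2" and y: "B * W z - N z * B' = \<i> * F * (W z)\<^sup>2"
  shows "((\<lambda>z. N z / W z) has_field_derivative F) (at z)"
proof -
  have "((\<lambda>z. N z / W z) has_derivative
      (\<lambda>h. - N z * (inverse (W z) * (of_real (Re h) * A' + of_real (Im h) * B') * inverse (W z)) +
        (of_real (Re h) * A + of_real (Im h) * B) / W z)) (at z)"
    by (rule has_derivative_divide[OF N W]) fact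
  moreover have "- N z * (inverse (W z) * (of_real (Re h) * A' + of_real (Im h) * B') * inverse (W z)) +
        (of_real (Re h) * A + of_real (Im h) * B) / W z = F * h" (is "?l = _") for h
  proof -
    have "?l * (W z)\<^sup>2 = of_real (Re h) * (A * W z - N z * A') + of_real (Im h) * (B * W z - N z * B')"
      using \<open>W z \<noteq> 0\<close> by (simp add: field_simps power2_eq_square)
    also have "\<dots> = F * (of_real (Re h) + \<i> * of_real (Im h)) * (W z)\<^sup>2"
      unfolding x y by (simp add: algebra_simps)
    also have "of_real (Re h) + \<i> * of_real (Im h) = h" by (simp add: complex_eq_iff)
    finally show ?thesis using \<open>W z \<noteq> 0\<close> by simp
  qed
  ultimately show ?thesis by (simp add: has_field_derivative_def)
qed

lemma has_derivative_of_real_Re: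
  assumes "(f has_real_derivative f') (at (Re z))"
  shows "((\<lambda>z. complex_of_real (f (Re z))) has_derivative (\<lambda>h. of_real (Re h) * of_real f')) (at z)"
proof -
  have "((\<lambda>z. f (Re z)) has_derivative (\<lambda>h. f' * Re h)) (at z)"
    using has_derivative_compose[OF has_derivative_Re[OF has_derivative_ident]] assms
    unfolding has_field_derivative_def by blast
  from has_derivative_of_real[OF this] show ?thesis by (simp add: mult.commute)
qed

lemma has_derivative_of_real_Im:
  assumes "(f has_real_derivative f') (at (Im z))"
  shows "((\<lambda>z. complex_of_real (f (Im z))) has_derivative (\<lambda>h. of_real (Im h) * of_real f')) (at z)"
proof -
  have "((\<lambda>z. f (Im z)) has_derivative (\<lambda>h. f' * Im h)) (at z)"
    using has_derivative_compose[OF has_derivative_Im[OF has_derivative_ident]] assms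
    unfolding has_field_derivative_def by blast
  from has_derivative_of_real[OF this] show ?thesis by (simp add: mult.commute)
qed

locale jacobi_pair =
  fixes k k' K K' :: real and s c d s' c' d' :: "real \<Rightarrow> real"
  assumes jac: "real_jacobi k K s c d" and jac': "real_jacobi k' K' s' c' d'"
    and k': "k'\<^sup>2 = 1 - k\<^sup>2"
begin

definition S where "S z = complex_of_real (s (Re z))"
definition C where "C z = complex_of_real (c (Re z))"
definition D where "D z = complex_of_real (d (Re z))"
definition S' where "S' z = complex_of_real (s' (Im z))"
definition C' where "C' z = complex_of_real (c' (Im z))"
definition D' where "D' z = complex_of_real (d' (Im z))"
abbreviation q where "q \<equiv> (complex_of_real k)\<^sup>2"

text \<open>Addition theorem at \<open>x + \<i> y\<close> combined with Jacobi's imaginary transformation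
  \<open>sn (\<i> y, k) = \<i> sn (y, k') / cn (y, k')\<close>, and so on.\<close>

definition W where "W z = (C' z)\<^sup>2 + q * (S z)\<^sup>2 * (S' z)\<^sup>2"
definition num_sn where "num_sn z = S z * D' z + \<i> * C z * D z * S' z * C' z"
definition num_cn where "num_cn z = C z * C' z - \<i> * S z * D z * S' z * D' z"
definition num_dn where "num_dn z = D z * D' z * C' z - \<i> * q * S z * C z * S' z"
definition sn where "sn z = num_sn z / W z"
definition cn where "cn z = num_cn z / W z"
definition dn where "dn z = num_dn z / W z"

lemma rels:
  "(C z)\<^sup>2 = 1 - (S z)\<^sup>2" "(D z)\<^sup>2 = 1 - q * (S z)\<^sup>2"
  "(C' z)\<^sup>2 = 1 - (S' z)\<^sup>2" "(D' z)\<^sup>2 = 1 - (1 - q) * (S' z)\<^sup>2"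
proof -
  show "(C z)\<^sup>2 = 1 - (S z)\<^sup>2" "(D z)\<^sup>2 = 1 - q * (S z)\<^sup>2"
    using jac by (auto simp: real_jacobi_def S_def C_def D_def simp flip: of_real_power)
  show "(C' z)\<^sup>2 = 1 - (S' z)\<^sup>2"  "(D' z)\<^sup>2 = 1 - (1 - q) * (S' z)\<^sup>2"
    using jac' unfolding real_jacobi_def S'_def C'_def D'_def k'
    by (auto simp flip: of_real_power)
qed

lemma basic_derivs:
  "(S has_derivative (\<lambda>h. of_real (Re h) * (C z * D z))) (at z)"
  "(C has_derivative (\<lambda>h. of_real (Re h) * - (S z * D z))) (at z)"
  "(D has_derivative (\<lambda>h. of_real (Re h) * - (q * S z * C z))) (at z)"
  "(S' has_derivative (\<lambda>h. of_real (Im h) * (C' z * D' z))) (at z)"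
  "(C' has_derivative (\<lambda>h. of_real (Im h) * - (S' z * D' z))) (at z)"
  "(D' has_derivative (\<lambda>h. of_real (Im h) * - ((1 - q) * S' z * C' z))) (at z)"
proof -
  have r: "(s has_real_derivative c x * d x) (at x)" "(c has_real_derivative - (s x * d x)) (at x)"
    "(d has_real_derivative - (k\<^sup>2 * s x * c x)) (at x)"
    "(s' has_real_derivative c' x * d' x) (at x)" "(c' has_real_derivative - (s' x * d' x)) (at x)"
    "(d' has_real_derivative - ((1 - k\<^sup>2) * s' x * c' x)) (at x)" for x
    using jac jac' unfolding real_jacobi_def k' by blast+
  show "(S has_derivative (\<lambda>h. of_real (Re h) * (C z * D z))) (at z)"
    using has_derivative_of_real_Re[OF r(1)] by (simp add: S_def[abs_def] C_def D_def)
  show "(C has_derivative (\<lambda>h. of_real (Re h) * - (S z * D z))) (at z)"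
    using has_derivative_of_real_Re[OF r(2)] by (simp add: S_def C_def[abs_def] D_def)
  show "(D has_derivative (\<lambda>h. of_real (Re h) * - (q * S z * C z))) (at z)"
    using has_derivative_of_real_Re[OF r(3)] by (simp add: S_def C_def D_def[abs_def])
  show "(S' has_derivative (\<lambda>h. of_real (Im h) * (C' z * D' z))) (at z)"
    using has_derivative_of_real_Im[OF r(4)] by (simp add: S'_def[abs_def] C'_def D'_def)
  show "(C' has_derivative (\<lambda>h. of_real (Im h) * - (S' z * D' z))) (at z)"
    using has_derivative_of_real_Im[OF r(5)] by (simp add: S'_def C'_def[abs_def] D'_def)
  show "(D' has_derivative (\<lambda>h. of_real (Im h) * - ((1 - q) * S' z * C' z))) (at z)"
    using has_derivative_of_real_Im[OF r(6)] by (simp add: S'_def C'_def D'_def[abs_def])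
qed

lemma W_deriv: "(W has_derivative (\<lambda>h. of_real (Re h) * (2 * q * S z * C z * D z * (S' z)\<^sup>2) +
    of_real (Im h) * (2 * S' z * C' z * D' z * (q * (S z)\<^sup>2 - 1)))) (at z)"
  unfolding W_def[abs_def]
  by (rule derivative_eq_intros basic_derivs refl)+ (simp add: fun_eq_iff algebra_simps power2_eq_square)

lemma num_sn_deriv: "(num_sn has_derivative (\<lambda>h.
    of_real (Re h) * (C z * D z * D' z - \<i> * S z * ((D z)\<^sup>2 + q * (C z)\<^sup>2) * S' z * C' z) +
    of_real (Im h) * (- S z * (1 - q) * S' z * C' z + \<i> * C z * D z * D' z * ((C' z)\<^sup>2 - (S' z)\<^sup>2)))) (at z)"
  unfolding num_sn_def[abs_def]
  by (rule derivative_eq_intros basic_derivs refl)+ (simp add: fun_eq_iff algebra_simps power2_eq_square)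

lemma num_cn_deriv: "(num_cn has_derivative (\<lambda>h.
    of_real (Re h) * (- S z * D z * C' z - \<i> * C z * ((D z)\<^sup>2 - q * (S z)\<^sup>2) * S' z * D' z) +
    of_real (Im h) * (- C z * S' z * D' z - \<i> * S z * D z * C' z * ((D' z)\<^sup>2 - (1 - q) * (S' z)\<^sup>2)))) (at z)"
  unfolding num_cn_def[abs_def]
  by (rule derivative_eq_intros basic_derivs refl)+ (simp add: fun_eq_iff algebra_simps power2_eq_square)

lemma num_dn_deriv: "(num_dn has_derivative (\<lambda>h.
    of_real (Re h) * (- q * S z * C z * D' z * C' z - \<i> * q * D z * ((C z)\<^sup>2 - (S z)\<^sup>2) * S' z) +
    of_real (Im h) * (- D z * S' z * ((D' z)\<^sup>2 + (1 - q) * (C' z)\<^sup>2) - \<i> * q * S z * C z * C' z * D' z))) (at z)"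
  unfolding num_dn_def[abs_def]
  by (rule derivative_eq_intros basic_derivs refl)+ (simp add: fun_eq_iff algebra_simps power2_eq_square)

text \<open>Multiplied by the square of \<open>W\<close>, each partial derivative condition is a
  polynomial identity in the six real functions, valid modulo the four quadratic relations
  \<open>rels\<close> and i^2 = -1; a Groebner basis computation settles it. The same holds for cn
  and dn.\<close>

lemma sn_deriv: assumes "W z \<noteq> 0" shows "(sn has_field_derivative cn z * dn z) (at z)"
  unfolding sn_def[abs_def]
proof (rule field_derivative_divide_from_partials[OF num_sn_deriv W_deriv assms])
  have e: "cn z * dn z * (W z)\<^sup>2 = num_cn z * num_dn z"
    using assms by (simp add: cn_def dn_def power2_eq_square)
  have i: "\<i>\<^sup>2 = -1" by simp
  show "(C z * D z * D' z - \<i> * S z * ((D z)\<^sup>2 + q * (C z)\<^sup>2) * S' z * C' z) * W z -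
    num_sn z * (2 * q * S z * C z * D z * (S' z)\<^sup>2) = cn z * dn z * (W z)\<^sup>2"
    unfolding e unfolding W_def num_sn_def num_cn_def num_dn_def using rels[of z] i by algebra
  have "(- S z * (1 - q) * S' z * C' z + \<i> * C z * D z * D' z * ((C' z)\<^sup>2 - (S' z)\<^sup>2)) * W z -
    num_sn z * (2 * S' z * C' z * D' z * (q * (S z)\<^sup>2 - 1)) = \<i> * (num_cn z * num_dn z)"
    unfolding W_def num_sn_def num_cn_def num_dn_def using rels[of z] i by algebra
  then show "(- S z * (1 - q) * S' z * C' z + \<i> * C z * D z * D' z * ((C' z)\<^sup>2 - (S' z)\<^sup>2)) * W z -
    num_sn z * (2 * S' z * C' z * D' z * (q * (S z)\<^sup>2 - 1)) = \<i> * (cn z * dn z) * (W z)\<^sup>2"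
    using e by (simp add: mult.assoc)
qed

lemma cn_deriv: assumes "W z \<noteq> 0" shows "(cn has_field_derivative - (sn z * dn z)) (at z)"
  unfolding cn_def[abs_def]
proof (rule field_derivative_divide_from_partials[OF num_cn_deriv W_deriv assms])
  have e: "- (sn z * dn z) * (W z)\<^sup>2 = - (num_sn z * num_dn z)"
    using assms by (simp add: sn_def dn_def power2_eq_square)
  have i: "\<i>\<^sup>2 = -1" by simp
  show "(- S z * D z * C' z - \<i> * C z * ((D z)\<^sup>2 - q * (S z)\<^sup>2) * S' z * D' z) * W z -
    num_cn z * (2 * q * S z * C z * D z * (S' z)\<^sup>2) = - (sn z * dn z) * (W z)\<^sup>2"
    unfolding e unfolding W_def num_sn_def num_cn_def num_dn_def using rels[of z] i by algebra
  have "(- C z * S' z * D' z - \<i> * S z * D z * C' z * ((D' z)\<^sup>2 - (1 - q) * (S' z)\<^sup>2)) * W z -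
    num_cn z * (2 * S' z * C' z * D' z * (q * (S z)\<^sup>2 - 1)) = \<i> * (- (num_sn z * num_dn z))"
    unfolding W_def num_sn_def num_cn_def num_dn_def using rels[of z] i by algebra
  then show "(- C z * S' z * D' z - \<i> * S z * D z * C' z * ((D' z)\<^sup>2 - (1 - q) * (S' z)\<^sup>2)) * W z -
    num_cn z * (2 * S' z * C' z * D' z * (q * (S z)\<^sup>2 - 1)) = \<i> * (- (sn z * dn z)) * (W z)\<^sup>2"
    unfolding mult.assoc[of \<i>] e .
qed

lemma dn_deriv: assumes "W z \<noteq> 0" shows "(dn has_field_derivative - (q * sn z * cn z)) (at z)"
  unfolding dn_def[abs_def]
proof (rule field_derivative_divide_from_partials[OF num_dn_deriv W_deriv assms])
  have e: "- (q * sn z * cn z) * (W z)\<^sup>2 = - (q * num_sn z * num_cn z)"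
    using assms by (simp add: sn_def cn_def power2_eq_square)
  have i: "\<i>\<^sup>2 = -1" by simp
  show "(- q * S z * C z * D' z * C' z - \<i> * q * D z * ((C z)\<^sup>2 - (S z)\<^sup>2) * S' z) * W z -
    num_dn z * (2 * q * S z * C z * D z * (S' z)\<^sup>2) = - (q * sn z * cn z) * (W z)\<^sup>2"
    unfolding e unfolding W_def num_sn_def num_cn_def num_dn_def using rels[of z] i by algebra
  have "(- D z * S' z * ((D' z)\<^sup>2 + (1 - q) * (C' z)\<^sup>2) - \<i> * q * S z * C z * C' z * D' z) * W z -
    num_dn z * (2 * S' z * C' z * D' z * (q * (S z)\<^sup>2 - 1)) = \<i> * (- (q * num_sn z * num_cn z))"
    unfolding W_def num_sn_def num_cn_def num_dn_def using rels[of z] i by algebra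
  then show "(- D z * S' z * ((D' z)\<^sup>2 + (1 - q) * (C' z)\<^sup>2) - \<i> * q * S z * C z * C' z * D' z) * W z -
    num_dn z * (2 * S' z * C' z * D' z * (q * (S z)\<^sup>2 - 1)) = \<i> * (- (q * sn z * cn z)) * (W z)\<^sup>2"
    unfolding mult.assoc[of \<i>] e .
qed

end

section \<open>Zeros of the denominator and poles of sn, cn, dn\<close>

text \<open>The reciprocal W / N has modulus at most sqrt(|W| / \<epsilon>), which tends to 0. A
  quadratic comparison is the right one because \<open>jacobi_pair.W\<close> vanishes to second
  order where the numerators vanish to first order.\<close>

lemma is_pole_if_numerator_dominates:
  fixes N W :: "complex \<Rightarrow> complex"
  assumes W: "W \<midarrow>p\<rightarrow> 0" and "0 < \<epsilon>"
    and ev: "\<forall>\<^sub>F w in at p. W w \<noteq> 0 \<and> \<epsilon> * norm (W w) \<le> (norm (N w))\<^sup>2"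
  shows "is_pole (\<lambda>w. N w / W w) p"
proof -
  have N: "\<forall>\<^sub>F w in at p. N w \<noteq> 0"
    using ev by eventually_elim
      (use \<open>0 < \<epsilon>\<close> in \<open>smt (verit) mult_pos_pos norm_zero power_zero_numeral zero_less_norm_iff\<close>)
  have "((\<lambda>w. norm (W w) / \<epsilon>) \<longlongrightarrow> norm (0::complex) / \<epsilon>) (at p)"
    using \<open>0 < \<epsilon>\<close> by (intro tendsto_intros W) simp
  then have lim: "((\<lambda>w. sqrt (norm (W w) / \<epsilon>)) \<longlongrightarrow> 0) (at p)"
    using tendsto_real_sqrt by fastforce
  have "((\<lambda>w. inverse (N w / W w)) \<longlongrightarrow> 0) (at p)"
  proof (rule Lim_null_comparison[OF _ lim])
    show "\<forall>\<^sub>F w in at p. norm (inverse (N w / W w)) \<le> sqrt (norm (W w) / \<epsilon>)"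
      using ev N
    proof eventually_elim
      case (elim w)
      have "(norm (W w) / norm (N w))\<^sup>2 * (\<epsilon> * (norm (N w))\<^sup>2) \<le> norm (W w) / \<epsilon> * (\<epsilon> * (norm (N w))\<^sup>2)"
        using elim \<open>0 < \<epsilon>\<close> mult_right_mono[of "\<epsilon> * norm (W w)" "(norm (N w))\<^sup>2" "norm (W w)"]
        by (simp add: power_divide power2_eq_square mult_ac)
      moreover have "0 < \<epsilon> * (norm (N w))\<^sup>2" using elim \<open>0 < \<epsilon>\<close> by simp
      ultimately have "(norm (W w) / norm (N w))\<^sup>2 \<le> norm (W w) / \<epsilon>"
        by (rule mult_right_le_imp_le)
      then show ?case by (intro real_le_rsqrt) (simp add: norm_divide norm_inverse)
    qed
  qed
  moreover have "\<forall>\<^sub>F w in at p. inverse (N w / W w) \<noteq> 0"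
    using ev N by eventually_elim simp
  ultimately have "filterlim (\<lambda>w. inverse (N w / W w)) (at 0) (at p)"
    by (simp add: filterlim_at)
  then show ?thesis
    unfolding is_pole_def using filterlim_inverse_at_iff by blast
qed

context jacobi_pair
begin

lemma K_pos: "0 < K" "0 < K'" and k_pos: "0 < k"
  using jac jac' by (auto simp: real_jacobi_def)

lemma W_eq: "W z = complex_of_real ((c' (Im z))\<^sup>2 + k\<^sup>2 * (s (Re z))\<^sup>2 * (s' (Im z))\<^sup>2)"
  by (simp add: W_def C'_def S_def S'_def)

lemma real_sq: "(c x)\<^sup>2 = 1 - (s x)\<^sup>2" "(d x)\<^sup>2 = 1 - k\<^sup>2 * (s x)\<^sup>2" "0 < d x"
   "(c' x)\<^sup>2 = 1 - (s' x)\<^sup>2" "(d' x)\<^sup>2 = 1 - (1 - k\<^sup>2) * (s' x)\<^sup>2" "0 < d' x"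
  using jac jac' unfolding real_jacobi_def k' by auto

lemma W_eq_0_iff': "W z = 0 \<longleftrightarrow> s (Re z) = 0 \<and> c' (Im z) = 0"
proof -
  have "W z = 0 \<longleftrightarrow> (c' (Im z))\<^sup>2 + k\<^sup>2 * (s (Re z))\<^sup>2 * (s' (Im z))\<^sup>2 = 0"
    unfolding W_eq of_real_eq_0_iff ..
  also have "\<dots> \<longleftrightarrow> (c' (Im z))\<^sup>2 = 0 \<and> k\<^sup>2 * (s (Re z))\<^sup>2 * (s' (Im z))\<^sup>2 = 0"
    by (rule add_nonneg_eq_0_iff) auto
  also have "\<dots> \<longleftrightarrow> s (Re z) = 0 \<and> c' (Im z) = 0"
    using real_sq(4)[of "Im z"] k_pos by auto
  finally show ?thesis .
qed

lemma W_eq_0_iff: "W z = 0 \<longleftrightarrow> (\<exists>m n::int. z = Complex (2 * of_int m * K) ((2 * of_int n + 1) * K'))"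
proof -
  have "s (Re z) = 0 \<longleftrightarrow> (\<exists>m::int. Re z = 2 * of_int m * K)"
    and "c' (Im z) = 0 \<longleftrightarrow> (\<exists>n::int. Im z = (2 * of_int n + 1) * K')"
    using jac jac' by (simp_all add: real_jacobi_def)
  then show ?thesis unfolding W_eq_0_iff' by (auto simp: complex_eq_iff)
qed

lemma isCont_W: "isCont W z"
  using W_deriv has_derivative_continuous by blast

text \<open>\<open>W\<close> is real-valued and not holomorphic, so the identity theorem does not
  apply. Instead the explicit zero set is used: distinct zeros differ by at least 2 K in the real
  part or 2 K' in the imaginary part.\<close>

lemma W_isolated: "\<forall>\<^sub>F w in at z. W w \<noteq> 0"
proof (cases "W z = 0")
  case False
  then show ?thesis using isCont_W[of z] tendsto_imp_eventually_ne by (auto simp: isCont_def)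
next
  case True
  then obtain m n :: int where z: "z = Complex (2 * of_int m * K) ((2 * of_int n + 1) * K')"
    using W_eq_0_iff by blast
  define r where "r = min (2 * K) (2 * K')"
  have "0 < r" using K_pos by (simp add: r_def)
  have "W w \<noteq> 0" if "w \<noteq> z" "dist w z < r" for w
  proof
    assume "W w = 0"
    then obtain m' n' :: int where w: "w = Complex (2 * of_int m' * K) ((2 * of_int n' + 1) * K')"
      using W_eq_0_iff by blast
    have "\<bar>Re (w - z)\<bar> < 2 * K" "\<bar>Im (w - z)\<bar> < 2 * K'"
      using that abs_Re_le_cmod[of "w - z"] abs_Im_le_cmod[of "w - z"] by (auto simp: r_def dist_norm)
    moreover have "Re (w - z) = of_int (m' - m) * (2 * K)" "Im (w - z) = of_int (n' - n) * (2 * K')"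
      by (simp_all add: w z algebra_simps)
    ultimately have "\<bar>of_int (m' - m)\<bar> * (2 * K) < 1 * (2 * K)" "\<bar>of_int (n' - n)\<bar> * (2 * K') < 1 * (2 * K')"
      using K_pos by (simp_all add: abs_mult)
    then have "\<bar>real_of_int (m' - m)\<bar> < 1" "\<bar>real_of_int (n' - n)\<bar> < 1"
      using K_pos by (simp_all only: mult_less_cancel_right_pos)
    then have "m' = m" "n' = n" by auto
    then show False using that w z by simp
  qed
  then show ?thesis unfolding eventually_at using \<open>0 < r\<close> by blast
qed

lemma open_W: "open {z. W z \<noteq> 0}"
  using isCont_W by (intro open_Collect_neq continuous_intros continuous_at_imp_continuous_on) auto

lemma nicely_meromorphic_quotient:
  assumes der: "\<And>z. W z \<noteq> 0 \<Longrightarrow> \<exists>D. (f has_field_derivative D) (at z)"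
    and f: "\<And>z. f z = N z / W z"
    and pole: "\<And>p. W p = 0 \<Longrightarrow> \<exists>\<epsilon>>0. \<forall>\<^sub>F w in at p. \<epsilon> * norm (W w) \<le> (norm (N w))\<^sup>2"
  shows "f nicely_meromorphic_on UNIV" and "is_pole f z \<longleftrightarrow> W z = 0"
proof -
  have holo: "f holomorphic_on {z. W z \<noteq> 0}"
    using der open_W by (auto simp: holomorphic_on_open)
  have is_pole: "is_pole f p" if p: "W p = 0" for p
  proof -
    obtain \<epsilon> where "\<epsilon> > 0" and ev: "\<forall>\<^sub>F w in at p. \<epsilon> * norm (W w) \<le> (norm (N w))\<^sup>2"
      using pole[OF p] by blast
    have "\<forall>\<^sub>F w in at p. W w \<noteq> 0 \<and> \<epsilon> * norm (W w) \<le> (norm (N w))\<^sup>2"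
      using ev W_isolated by eventually_elim simp
    then have "is_pole (\<lambda>w. N w / W w) p"
      using is_pole_if_numerator_dominates[OF _ \<open>\<epsilon> > 0\<close>] isCont_W[of p] p by (auto simp: isCont_def)
    then show ?thesis unfolding f .
  qed
  show "is_pole f z \<longleftrightarrow> W z = 0"
    using is_pole not_is_pole_holomorphic[OF open_W _ holo] by blast
  show "f nicely_meromorphic_on UNIV"
  proof (rule nicely_meromorphic_onI_open[where pts = "{z. W z = 0}"])
    have "- {z. W z = 0} = {z. W z \<noteq> 0}" by blast
    then show "f analytic_on UNIV - {z. W z = 0}"
      using holo open_W analytic_on_open by (simp add: Compl_eq_Diff_UNIV[symmetric])
    \<comment> \<open>The value at a pole is N / 0 = 0, exactly what nice meromorphy
      prescribes.\<close>
    show "is_pole f x \<and> f x = 0" if "x \<in> {z. W z = 0}" for x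
      using is_pole that by (simp add: f)
    show "isolated_singularity_at f x" for x
    proof -
      obtain r where "r > 0" and r: "\<And>w. w \<noteq> x \<Longrightarrow> dist w x < r \<Longrightarrow> W w \<noteq> 0"
        using W_isolated[of x] by (auto simp: eventually_at)
      have "f holomorphic_on ball x r - {x}"
        by (rule holomorphic_on_subset[OF holo]) (use r in \<open>auto simp: dist_commute\<close>)
      then show ?thesis
        using \<open>r > 0\<close> isolated_singularity_at_holomorphic[of f "ball x r"] by simp
    qed
  qed simp
qed

lemma norm_W: "norm (W z) \<le> (c' (Im z))\<^sup>2 + (s (Re z))\<^sup>2"
proof -
  have "k\<^sup>2 * (s' (Im z))\<^sup>2 \<le> 1 * 1"
  proof (rule mult_mono)
    show "k\<^sup>2 \<le> 1" using jac by (simp add: real_jacobi_def power_le_one)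
    show "(s' (Im z))\<^sup>2 \<le> 1" using real_sq(4)[of "Im z"] zero_le_power2[of "c' (Im z)"] by linarith
  qed auto
  from mult_right_mono[OF this, of "(s (Re z))\<^sup>2"] show ?thesis
    unfolding W_eq norm_of_real by (simp add: mult_ac)
qed

lemma real_continuous:
  "isCont s x" "isCont c x" "isCont d x" "isCont s' x" "isCont c' x" "isCont d' x"
  using jac jac' unfolding real_jacobi_def by (blast intro: DERIV_isCont)+

text \<open>By \<open>norm_W\<close>, the modulus of \<open>W\<close> is at most the sum of the
  squares of s and c'. The squared modulus of the numerator is a combination of the same two squares
  whose coefficients stay, near p, above half of the smaller of their values at p.\<close>

lemma numerator_bound:
  assumes "W p = 0"
    and N: "\<And>z. (norm (N z))\<^sup>2 = A z * (s (Re z))\<^sup>2 + B z * (c' (Im z))\<^sup>2"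
    and "isCont A p" "isCont B p" "0 < A p" "0 < B p"
  shows "\<exists>\<epsilon>>0. \<forall>\<^sub>F w in at p. \<epsilon> * norm (W w) \<le> (norm (N w))\<^sup>2"
proof (intro exI conjI)
  define \<epsilon> where "\<epsilon> = min (A p) (B p) / 2"
  show "0 < \<epsilon>" using assms by (simp add: \<epsilon>_def)
  have "\<forall>\<^sub>F w in at p. \<epsilon> < A w" "\<forall>\<^sub>F w in at p. \<epsilon> < B w"
    using assms order_tendstoD(1)[of A "A p" "at p" \<epsilon>] order_tendstoD(1)[of B "B p" "at p" \<epsilon>]
    by (auto simp: isCont_def \<epsilon>_def min_def)
  then show "\<forall>\<^sub>F w in at p. \<epsilon> * norm (W w) \<le> (norm (N w))\<^sup>2"
  proof eventually_elim
    case (elim w)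
    have "\<epsilon> * norm (W w) \<le> \<epsilon> * (s (Re w))\<^sup>2 + \<epsilon> * (c' (Im w))\<^sup>2"
      using mult_left_mono[OF norm_W[of w], of \<epsilon>] \<open>0 < \<epsilon>\<close> by (simp add: algebra_simps)
    also have "\<dots> \<le> A w * (s (Re w))\<^sup>2 + B w * (c' (Im w))\<^sup>2"
      using elim by (intro add_mono mult_right_mono) auto
    finally show ?case by (simp add: N)
  qed
qed

lemma at_pole:
  assumes "W p = 0"
  shows "(s (Re p))\<^sup>2 = 0" "(c (Re p))\<^sup>2 = 1" "(d (Re p))\<^sup>2 = 1"
    "(c' (Im p))\<^sup>2 = 0" "(s' (Im p))\<^sup>2 = 1" "(d' (Im p))\<^sup>2 = k\<^sup>2"
  using assms real_sq[of "Re p"] real_sq[of "Im p"] by (auto simp: W_eq_0_iff')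

lemma continuous_parts:
  "isCont (\<lambda>z. s (Re z)) p" "isCont (\<lambda>z. c (Re z)) p" "isCont (\<lambda>z. d (Re z)) p"
  "isCont (\<lambda>z. s' (Im z)) p" "isCont (\<lambda>z. c' (Im z)) p" "isCont (\<lambda>z. d' (Im z)) p"
  using real_continuous by (auto intro: isCont_o2[where f = Re] isCont_o2[where f = Im] continuous_intros)

text \<open>In each of the three numerators one of the real and imaginary parts contains the factor
  s and the other the factor c', which gives the diagonal form that \<open>numerator_bound\<close>
  asks for.\<close>

lemma norm_num_sn: "(norm (num_sn z))\<^sup>2 = (d' (Im z))\<^sup>2 * (s (Re z))\<^sup>2 +
    ((c (Re z))\<^sup>2 * (d (Re z))\<^sup>2 * (s' (Im z))\<^sup>2) * (c' (Im z))\<^sup>2"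
  unfolding num_sn_def S_def C_def D_def S'_def C'_def D'_def cmod_power2 by (simp add: power_mult_distrib)

lemma norm_num_cn: "(norm (num_cn z))\<^sup>2 = ((d (Re z))\<^sup>2 * (s' (Im z))\<^sup>2 * (d' (Im z))\<^sup>2) * (s (Re z))\<^sup>2 +
    (c (Re z))\<^sup>2 * (c' (Im z))\<^sup>2"
  unfolding num_cn_def S_def C_def D_def S'_def C'_def D'_def cmod_power2 by (simp add: power_mult_distrib)

lemma norm_num_dn: "(norm (num_dn z))\<^sup>2 = (k ^ 4 * (c (Re z))\<^sup>2 * (s' (Im z))\<^sup>2) * (s (Re z))\<^sup>2 +
    ((d (Re z))\<^sup>2 * (d' (Im z))\<^sup>2) * (c' (Im z))\<^sup>2"
  unfolding num_dn_def S_def C_def D_def S'_def C'_def D'_def cmod_power2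
  by (simp add: power_mult_distrib flip: of_real_power)

lemma sn_meromorphic: "sn nicely_meromorphic_on UNIV" and is_pole_sn: "is_pole sn z \<longleftrightarrow> W z = 0"
proof -
  have "\<exists>\<epsilon>>0. \<forall>\<^sub>F w in at p. \<epsilon> * norm (W w) \<le> (norm (num_sn w))\<^sup>2" if "W p = 0" for p
    by (rule numerator_bound[OF that norm_num_sn])
      (use at_pole[OF that] k_pos in \<open>auto intro!: continuous_intros continuous_parts\<close>)
  from nicely_meromorphic_quotient[OF _ sn_def this] sn_deriv
  show "sn nicely_meromorphic_on UNIV" "is_pole sn z \<longleftrightarrow> W z = 0" by blast+
qed

lemma cn_meromorphic: "cn nicely_meromorphic_on UNIV" and is_pole_cn: "is_pole cn z \<longleftrightarrow> W z = 0"
proof -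
  have "\<exists>\<epsilon>>0. \<forall>\<^sub>F w in at p. \<epsilon> * norm (W w) \<le> (norm (num_cn w))\<^sup>2" if "W p = 0" for p
    by (rule numerator_bound[OF that norm_num_cn])
      (use at_pole[OF that] k_pos in \<open>auto intro!: continuous_intros continuous_parts\<close>)
  from nicely_meromorphic_quotient[OF _ cn_def this] cn_deriv
  show "cn nicely_meromorphic_on UNIV" "is_pole cn z \<longleftrightarrow> W z = 0" by blast+
qed

lemma dn_meromorphic: "dn nicely_meromorphic_on UNIV" and is_pole_dn: "is_pole dn z \<longleftrightarrow> W z = 0"
proof -
  have "\<exists>\<epsilon>>0. \<forall>\<^sub>F w in at p. \<epsilon> * norm (W w) \<le> (norm (num_dn w))\<^sup>2" if "W p = 0" for p
    by (rule numerator_bound[OF that norm_num_dn])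
      (use at_pole[OF that] k_pos in \<open>auto intro!: continuous_intros continuous_parts\<close>)
  from nicely_meromorphic_quotient[OF _ dn_def this] dn_deriv
  show "dn nicely_meromorphic_on UNIV" "is_pole dn z \<longleftrightarrow> W z = 0" by blast+
qed

lemma at_0: "W 0 = 1" "sn 0 = 0" "cn 0 = 1" "dn 0 = 1"
  using jac jac' by (auto simp: real_jacobi_def sn_def cn_def dn_def num_sn_def num_cn_def
      num_dn_def W_def S_def C_def D_def S'_def C'_def D'_def)

lemma is_jacobi_triple: "is_jacobi_triple k sn cn dn"
  unfolding is_jacobi_triple_def is_pole_sn is_pole_cn is_pole_dn
  using sn_meromorphic cn_meromorphic dn_meromorphic sn_deriv cn_deriv dn_deriv at_0 by simp

end

section \<open>Uniqueness of the Jacobi functions\<close>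

text \<open>By the identity theorem the difference vanishes near every point, up to the point
  itself. The value there is then forced: it is the common limit, or 0 at a common pole.\<close>

lemma nicely_meromorphic_eqI:
  assumes f: "f nicely_meromorphic_on UNIV" and g: "g nicely_meromorphic_on UNIV"
    and ev: "\<forall>\<^sub>F w in at z\<^sub>0. f w = g w"
  shows "f = g"
proof
  fix z
  have "(\<lambda>w. f w - g w) meromorphic_on UNIV"
    using f g by (intro meromorphic_intros) (auto simp: nicely_meromorphic_on_def)
  from meromorphic_imp_constant_or_avoid[OF this, of 0]
  have "(\<forall>w. \<forall>\<^sub>F v in at w. f v - g v = 0) \<or> (\<forall>w. \<forall>\<^sub>F v in at w. f v - g v \<noteq> 0)"
    by (auto simp: eventually_cosparse_open_eq)
  moreover have "\<not> (\<forall>\<^sub>F v in at z\<^sub>0. f v - g v \<noteq> 0)"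
  proof
    assume "\<forall>\<^sub>F v in at z\<^sub>0. f v - g v \<noteq> 0"
    with ev have "\<forall>\<^sub>F v in at z\<^sub>0. False" by eventually_elim simp
    then show False by simp
  qed
  ultimately have eq: "\<forall>\<^sub>F v in at z. f v = g v" by (auto elim: eventually_mono)
  have f': "is_pole f z \<and> f z = 0 \<or> f \<midarrow>z\<rightarrow> f z" and g': "is_pole g z \<and> g z = 0 \<or> g \<midarrow>z\<rightarrow> g z"
    using f g by (auto simp: nicely_meromorphic_on_def)
  have "is_pole f z \<longleftrightarrow> is_pole g z" using eq by (intro is_pole_cong) auto
  moreover have "\<not> (is_pole f z \<and> f \<midarrow>z\<rightarrow> f z)" "\<not> (is_pole g z \<and> g \<midarrow>z\<rightarrow> g z)"
    using not_tendsto_and_filterlim_at_infinity[of "at z"] by (auto simp: is_pole_def)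
  moreover have "f z = g z" if "f \<midarrow>z\<rightarrow> f z" "g \<midarrow>z\<rightarrow> g z"
    using that tendsto_cong[OF eq] LIM_unique by blast
  ultimately show "f z = g z" using f' g' by auto
qed

text \<open>Picard's contraction argument in the form of a maximum principle: at a maximum point of
  the total difference E on a small disc, the mean value inequality bounds each component by E/4, so
  E \<le> 3/4 E and E vanishes.\<close>

lemma jacobi_ode_local_unique:
  fixes s c d s' c' d' :: "complex \<Rightarrow> complex" and q :: complex
  assumes "0 < r" and q: "norm q \<le> 1"
    and s: "\<And>w. norm w < r \<Longrightarrow> (s has_field_derivative c w * d w) (at w)"
    and c: "\<And>w. norm w < r \<Longrightarrow> (c has_field_derivative - (s w * d w)) (at w)"
    and d: "\<And>w. norm w < r \<Longrightarrow> (d has_field_derivative - (q * s w * c w)) (at w)"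
    and s': "\<And>w. norm w < r \<Longrightarrow> (s' has_field_derivative c' w * d' w) (at w)"
    and c': "\<And>w. norm w < r \<Longrightarrow> (c' has_field_derivative - (s' w * d' w)) (at w)"
    and d': "\<And>w. norm w < r \<Longrightarrow> (d' has_field_derivative - (q * s' w * c' w)) (at w)"
    and init: "s 0 = s' 0" "c 0 = c' 0" "d 0 = d' 0"
  obtains \<rho> where "0 < \<rho>" "\<And>w. norm w \<le> \<rho> \<Longrightarrow> s w = s' w \<and> c w = c' w \<and> d w = d' w"
proof -
  define E where "E w = norm (s w - s' w) + norm (c w - c' w) + norm (d w - d' w)" for w
  define F where "F w = norm (s w) + norm (c w) + norm (d w) + norm (s' w) + norm (c' w) + norm (d' w)" for w
  have cont: "isCont s w" "isCont c w" "isCont d w" "isCont s' w" "isCont c' w" "isCont d' w"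
    if "norm w < r" for w
    using that s c d s' c' d' by (blast intro: DERIV_isCont)+
  have "continuous_on (cball 0 (r/2)) F"
    unfolding F_def using \<open>0 < r\<close>
    by (intro continuous_intros continuous_at_imp_continuous_on ballI cont) auto
  then have "bounded (F ` cball 0 (r/2))"
    by (intro compact_imp_bounded compact_continuous_image) auto
  then obtain M where "M > 0" and M': "\<And>w. norm w \<le> r/2 \<Longrightarrow> norm (F w) \<le> M"
    by (auto simp: bounded_pos)
  have M: "norm (s w) \<le> M" "norm (c w) \<le> M" "norm (d w) \<le> M"
    "norm (s' w) \<le> M" "norm (c' w) \<le> M" "norm (d' w) \<le> M" if "norm w \<le> r/2" for w
    using M'[OF that] by (auto simp: F_def intro: order_trans[rotated])
  \<comment> \<open>The radius 1 / (4 M) turns the derivative bound M E into E/4 per component;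
    three components then leave a factor 3/4 below 1.\<close>
  define \<rho> where "\<rho> = min (r/2) (1 / (4 * M))"
  have \<rho>: "0 < \<rho>" "\<rho> \<le> r/2" "\<rho> * M \<le> 1/4"
    using \<open>0 < r\<close> \<open>0 < M\<close> by (auto simp: \<rho>_def min_def field_simps)
  have "continuous_on (cball 0 \<rho>) E"
    unfolding E_def using \<open>0 < r\<close> \<rho>
    by (intro continuous_intros continuous_at_imp_continuous_on ballI cont) auto
  then obtain w\<^sub>0 where w\<^sub>0: "norm w\<^sub>0 \<le> \<rho>" and max: "\<And>w. norm w \<le> \<rho> \<Longrightarrow> E w \<le> E w\<^sub>0"
    using continuous_attains_sup[of "cball 0 \<rho>" E] \<rho> by auto
  have prod: "norm (a * b - a' * b') \<le> M * E w\<^sub>0"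
    if "norm a \<le> M" "norm b' \<le> M" "norm (a - a') + norm (b - b') \<le> E w\<^sub>0" for a a' b b' :: complex
  proof -
    have "a * b - a' * b' = a * (b - b') + (a - a') * b'" by (simp add: algebra_simps)
    also have "norm \<dots> \<le> M * norm (b - b') + norm (a - a') * M"
      by (intro norm_triangle_mono) (auto simp: norm_mult intro!: mult_mono that less_imp_le[OF \<open>M > 0\<close>])
    also have "\<dots> = M * (norm (a - a') + norm (b - b'))" by (simp add: algebra_simps)
    also have "\<dots> \<le> M * E w\<^sub>0" using that \<open>M > 0\<close> by simp
    finally show ?thesis .
  qed
  have bound: "norm (f w\<^sub>0) \<le> E w\<^sub>0 / 4"
    if "\<And>w. norm w \<le> \<rho> \<Longrightarrow> (f has_field_derivative f' w) (at w)"
      and "\<And>w. norm w \<le> \<rho> \<Longrightarrow> norm (f' w) \<le> M * E w\<^sub>0" and "f 0 = 0"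
    for f f' :: "complex \<Rightarrow> complex"
  proof -
    have "norm (f w\<^sub>0 - f 0) \<le> M * E w\<^sub>0 * norm (w\<^sub>0 - 0)"
      by (rule field_differentiable_bound[of "cball 0 \<rho>"])
        (use that w\<^sub>0 \<rho> in \<open>auto intro: DERIV_subset\<close>)
    also have "\<dots> \<le> M * E w\<^sub>0 * \<rho>"
      using w\<^sub>0 \<open>M > 0\<close> by (intro mult_left_mono) (auto simp: E_def)
    also have "\<dots> = (\<rho> * M) * E w\<^sub>0" by simp
    also have "\<dots> \<le> 1/4 * E w\<^sub>0" using \<rho> by (intro mult_right_mono) (auto simp: E_def)
    finally show ?thesis using that by simp
  qed
  have "norm (s w\<^sub>0 - s' w\<^sub>0) \<le> E w\<^sub>0 / 4"
  proof (rule bound)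
    fix w :: complex assume w: "norm w \<le> \<rho>"
    then show "((\<lambda>w. s w - s' w) has_field_derivative c w * d w - c' w * d' w) (at w)"
      using \<rho> \<open>0 < r\<close> by (intro derivative_intros s s') auto
    show "norm (c w * d w - c' w * d' w) \<le> M * E w\<^sub>0"
      using max[OF w] w \<rho> by (intro prod M) (auto simp: E_def intro: order_trans[rotated])
  qed (simp add: init)
  moreover have "norm (c w\<^sub>0 - c' w\<^sub>0) \<le> E w\<^sub>0 / 4"
  proof (rule bound)
    fix w :: complex assume w: "norm w \<le> \<rho>"
    then show "((\<lambda>w. c w - c' w) has_field_derivative - (s w * d w) - - (s' w * d' w)) (at w)"
      using \<rho> \<open>0 < r\<close> by (intro derivative_intros c c') auto
    have "norm (s w * d w - s' w * d' w) \<le> M * E w\<^sub>0"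
      using max[OF w] w \<rho> by (intro prod M) (auto simp: E_def intro: order_trans[rotated])
    then show "norm (- (s w * d w) - - (s' w * d' w)) \<le> M * E w\<^sub>0" by (simp add: norm_minus_commute)
  qed (simp add: init)
  moreover have "norm (d w\<^sub>0 - d' w\<^sub>0) \<le> E w\<^sub>0 / 4"
  proof (rule bound)
    fix w :: complex assume w: "norm w \<le> \<rho>"
    then show "((\<lambda>w. d w - d' w) has_field_derivative - (q * s w * c w) - - (q * s' w * c' w)) (at w)"
      using \<rho> \<open>0 < r\<close> by (intro derivative_intros d d') auto
    have *: "norm (s w * c w - s' w * c' w) \<le> M * E w\<^sub>0"
      using max[OF w] w \<rho> by (intro prod M) (auto simp: E_def intro: order_trans[rotated])
    have "- (q * s w * c w) - - (q * s' w * c' w) = - q * (s w * c w - s' w * c' w)"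
      by (simp add: algebra_simps)
    also have "norm \<dots> \<le> 1 * (M * E w\<^sub>0)"
      unfolding norm_mult norm_minus_cancel using q * by (intro mult_mono) auto
    finally show "norm (- (q * s w * c w) - - (q * s' w * c' w)) \<le> M * E w\<^sub>0" by simp
  qed (simp add: init)
  ultimately have "E w\<^sub>0 \<le> 3 / 4 * E w\<^sub>0" by (simp add: E_def)
  then have "E w\<^sub>0 \<le> 0" by simp
  then have "E w \<le> 0" if "norm w \<le> \<rho>" for w using max[OF that] by simp
  then have "s w = s' w \<and> c w = c' w \<and> d w = d' w" if "norm w \<le> \<rho>" for w
    using that unfolding E_def by (smt (verit) norm_ge_zero zero_less_norm_iff right_minus_eq)
  with \<rho>(1) show ?thesis by (rule that)
qed

text \<open>The differential equations hold only off the poles, so a pole-free disc around 0 comes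
  first; local uniqueness on it spreads to the plane by
  \<open>nicely_meromorphic_eqI\<close>.\<close>

lemma is_jacobi_triple_unique:
  assumes k: "\<bar>k\<bar> \<le> 1" and 1: "is_jacobi_triple k s c d" and 2: "is_jacobi_triple k s' c' d'"
  shows "s = s' \<and> c = c' \<and> d = d'"
proof -
  have no_pole: "\<forall>\<^sub>F w in nhds 0. \<not> is_pole f w"
    if f: "f nicely_meromorphic_on UNIV" "\<not> is_pole f 0" for f :: "complex \<Rightarrow> complex"
  proof -
    obtain A where "open A" "0 \<in> A" "f holomorphic_on A"
      using nicely_meromorphic_on_imp_analytic_at[OF f(1) _ f(2)] by (auto simp: analytic_at)
    then show ?thesis unfolding eventually_nhds using not_is_pole_holomorphic by blast
  qed
  have "\<forall>\<^sub>F w in nhds 0. (\<not> is_pole s w \<and> \<not> is_pole c w \<and> \<not> is_pole d w) \<and>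
      (\<not> is_pole s' w \<and> \<not> is_pole c' w \<and> \<not> is_pole d' w)"
    using 1 2 unfolding is_jacobi_triple_def by (intro eventually_conj no_pole) auto
  then obtain r where r: "0 < r"
    "\<And>w. norm w < r \<Longrightarrow> \<not> is_pole s w \<and> \<not> is_pole c w \<and> \<not> is_pole d w"
    "\<And>w. norm w < r \<Longrightarrow> \<not> is_pole s' w \<and> \<not> is_pole c' w \<and> \<not> is_pole d' w"
    unfolding eventually_nhds_metric by auto
  have q: "norm ((complex_of_real k)\<^sup>2) \<le> 1"
    using k by (simp add: norm_power abs_square_le_1)
  obtain \<rho> where "0 < \<rho>" and eq: "\<And>w. norm w \<le> \<rho> \<Longrightarrow> s w = s' w \<and> c w = c' w \<and> d w = d' w"
    by (rule jacobi_ode_local_unique[OF r(1) q, of s c d s' c' d'])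
      (use 1 2 r(2,3) in \<open>auto simp: is_jacobi_triple_def\<close>)
  have "\<forall>\<^sub>F w in at 0. norm w \<le> \<rho>"
    unfolding eventually_at using \<open>0 < \<rho>\<close> by (intro exI[of _ \<rho>]) auto
  then have "\<forall>\<^sub>F w in at 0. s w = s' w" "\<forall>\<^sub>F w in at 0. c w = c' w" "\<forall>\<^sub>F w in at 0. d w = d' w"
    by (auto elim!: eventually_mono simp: eq)
  then show ?thesis
    using 1 2 unfolding is_jacobi_triple_def by (blast intro: nicely_meromorphic_eqI)
qed

lemma (in jacobi_pair) jacobi_triple_eq: "jacobi_triple k = (sn, cn, dn)"
  unfolding jacobi_triple_def
proof (rule the_equality)
  show "case (sn, cn, dn) of (s, c, d) \<Rightarrow> is_jacobi_triple k s c d"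
    using is_jacobi_triple by simp
  fix p assume "case p of (s, c, d) \<Rightarrow> is_jacobi_triple k s c d"
  moreover have "\<bar>k\<bar> \<le> 1" using jac by (simp add: real_jacobi_def)
  ultimately show "p = (sn, cn, dn)"
    using is_jacobi_triple_unique[OF _ _ is_jacobi_triple] by (cases p) auto
qed

section \<open>Partial fractions over square arrays of poles\<close>

definition lattice_point :: "real \<Rightarrow> real \<Rightarrow> int \<times> int \<Rightarrow> complex" where
  "lattice_point K K' = (\<lambda>(n, m). Complex (of_int n * K) (of_int m * K'))"

definition odd_square :: "nat \<Rightarrow> (int \<times> int) set" where
  "odd_square N = {(n, m). \<bar>n\<bar> \<le> int N \<and> \<bar>m\<bar> \<le> int N \<and> odd (n + m)}"

lemma finite_odd_square: "finite (odd_square N)"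
  by (rule finite_subset[of _ "{-int N..int N} \<times> {-int N..int N}"]) (auto simp: odd_square_def)

lemma lattice_point_inj:
  assumes "K \<noteq> 0" "K' \<noteq> 0" shows "inj (lattice_point K K')"
  using assms by (auto simp: inj_def lattice_point_def)

text \<open>The contour has half-widths (N + 1/2) K and (N + 1/2) K', its open neighbourhood uses N
  + 3/4. Both enclose the same lattice points, those of the square of size N.\<close>

lemma abs_of_int_mult_less_iff:
  fixes K :: real assumes "0 < K"
  shows "\<bar>of_int n * K\<bar> < (of_nat N + 3/4) * K \<longleftrightarrow> \<bar>n\<bar> \<le> int N"
    and "\<bar>of_int n * K\<bar> < (of_nat N + 1/2) * K \<longleftrightarrow> \<bar>n\<bar> \<le> int N"
proof -
  have "\<bar>of_int n * K\<bar> < (of_nat N + e) * K \<longleftrightarrow> real_of_int \<bar>n\<bar> < of_nat N + e" for e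
    using assms by (simp add: abs_mult)
  moreover have "real_of_int \<bar>n\<bar> < of_nat N + 3/4 \<longleftrightarrow> \<bar>n\<bar> \<le> int N"
    "real_of_int \<bar>n\<bar> < of_nat N + 1/2 \<longleftrightarrow> \<bar>n\<bar> \<le> int N" by linarith+
  ultimately show "\<bar>of_int n * K\<bar> < (of_nat N + 3/4) * K \<longleftrightarrow> \<bar>n\<bar> \<le> int N"
    "\<bar>of_int n * K\<bar> < (of_nat N + 1/2) * K \<longleftrightarrow> \<bar>n\<bar> \<le> int N" by simp_all
qed

lemma contour_integral_rectpath_bound:
  assumes "f contour_integrable_on (rectpath a b)" "0 \<le> B"
    and le: "Re a \<le> Re b" "Im a \<le> Im b"
    and B: "\<And>w. w \<in> path_image (rectpath a b) \<Longrightarrow> norm (f w) \<le> B"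
  shows "norm (contour_integral (rectpath a b) f) \<le> B * (2 * (Re b - Re a) + 2 * (Im b - Im a))"
proof -
  define a2 a4 where "a2 = Complex (Re b) (Im a)" and "a4 = Complex (Re a) (Im b)"
  have path: "rectpath a b = linepath a a2 +++ linepath a2 b +++ linepath b a4 +++ linepath a4 a"
    by (simp add: rectpath_def Let_def a2_def a4_def)
  have img: "path_image (rectpath a b) =
      closed_segment a a2 \<union> closed_segment a2 b \<union> closed_segment b a4 \<union> closed_segment a4 a"
    by (simp add: path path_image_join Un_assoc)
  have int: "f contour_integrable_on linepath a a2" "f contour_integrable_on linepath a2 b"
    "f contour_integrable_on linepath b a4" "f contour_integrable_on linepath a4 a"
    using assms(1) by (auto simp: path)
  have "norm (contour_integral (linepath a a2) f) \<le> B * norm (a2 - a)"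
    "norm (contour_integral (linepath a2 b) f) \<le> B * norm (b - a2)"
    "norm (contour_integral (linepath b a4) f) \<le> B * norm (a4 - b)"
    "norm (contour_integral (linepath a4 a) f) \<le> B * norm (a - a4)"
    by (rule contour_integral_bound_linepath; use int assms img in auto)+
  moreover have "norm (a2 - a) = Re b - Re a" "norm (b - a2) = Im b - Im a"
    "norm (a4 - b) = Re b - Re a" "norm (a - a4) = Im b - Im a"
    using le by (auto simp: a2_def a4_def cmod_def)
  moreover have "contour_integral (rectpath a b) f = contour_integral (linepath a a2) f +
      (contour_integral (linepath a2 b) f + (contour_integral (linepath b a4) f + contour_integral (linepath a4 a) f))"
    using int by (simp add: path)
  ultimately show ?thesis
    using norm_triangle_ineq[of "contour_integral (linepath a a2) f"
        "contour_integral (linepath a2 b) f + (contour_integral (linepath b a4) f + contour_integral (linepath a4 a) f)"]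
      norm_triangle_ineq[of "contour_integral (linepath a2 b) f" "contour_integral (linepath b a4) f + contour_integral (linepath a4 a) f"]
      norm_triangle_ineq[of "contour_integral (linepath b a4) f" "contour_integral (linepath a4 a) f"]
    by (simp add: algebra_simps)
qed

text \<open>These are the only facts about sn / cd that the residue argument uses. The bound is
  imposed on the grid of half-integer lines because that grid carries the boundaries of all the
  rectangles at once.\<close>

locale odd_lattice_function =
  fixes K K' :: real and G :: "complex \<Rightarrow> complex" and \<rho> :: "int \<times> int \<Rightarrow> complex"
  assumes K: "0 < K" "0 < K'"
    and holo: "G holomorphic_on - {lattice_point K K' (n, m) | n m. odd (n + m)}"
    and G_minus: "\<And>w. G (- w) = - G w"
    and res: "\<And>n m. odd (n + m) \<Longrightarrow>
      ((\<lambda>w. G w * (w - lattice_point K K' (n, m))) \<longlongrightarrow> \<rho> (n, m)) (at (lattice_point K K' (n, m)))"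
    and bound: "\<exists>B. \<forall>w. (\<exists>j::int. Re w = (of_int j + 1/2) * K \<or> Im w = (of_int j + 1/2) * K') \<longrightarrow> norm (G w) \<le> B"
begin

text \<open>The kernel \<open>2 u / (w\<^sup>2 - u\<^sup>2) = 1 / (w - u) - 1 / (w + u)\<close> decays quadratically, so that the
  boundary integrals over the rectangles tend to \<open>0\<close>; by oddness of \<open>G\<close> both of its poles
  contribute \<open>G u\<close>.\<close>

lemma residue_sum:
  assumes u: "u \<noteq> 0" "\<bar>Re u\<bar> < K" "\<bar>Im u\<bar> < K'" and N: "1 \<le> N"
  defines "b \<equiv> Complex ((of_nat N + 1/2) * K) ((of_nat N + 1/2) * K')"
  defines "\<Phi> \<equiv> \<lambda>w. G w * (2 * u / (w\<^sup>2 - u\<^sup>2))"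
  shows "contour_integral (rectpath (- b) b) \<Phi> =
      2 * pi * \<i> * ((\<Sum>p\<in>odd_square N. \<rho> p * (2 * u / ((lattice_point K K' p)\<^sup>2 - u\<^sup>2))) + 2 * G u)"
    and "\<Phi> contour_integrable_on (rectpath (- b) b)"
proof -
  define L where "L = lattice_point K K'"
  \<comment> \<open>A slightly larger open box without further lattice points, on which
    \<open>pts\<close> contains every singularity.\<close>
  define b' where "b' = Complex ((of_nat N + 3/4) * K) ((of_nat N + 3/4) * K')"
  define A where "A = box (- b') b'"
  define pts where "pts = L ` odd_square N \<union> {u, - u}"
  have in_A: "w \<in> A \<longleftrightarrow> \<bar>Re w\<bar> < (of_nat N + 3/4) * K \<and> \<bar>Im w\<bar> < (of_nat N + 3/4) * K'" for w
    by (auto simp: A_def b'_def in_box_complex_iff)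
  have in_b: "w \<in> box (- b) b \<longleftrightarrow> \<bar>Re w\<bar> < (of_nat N + 1/2) * K \<and> \<bar>Im w\<bar> < (of_nat N + 1/2) * K'" for w
    by (auto simp: b_def in_box_complex_iff)
  have L_in: "L (n, m) \<in> A \<longleftrightarrow> \<bar>n\<bar> \<le> int N \<and> \<bar>m\<bar> \<le> int N" "L (n, m) \<in> box (- b) b \<longleftrightarrow> \<bar>n\<bar> \<le> int N \<and> \<bar>m\<bar> \<le> int N" for n m
    unfolding in_A in_b L_def lattice_point_def using K by (simp_all add: abs_of_int_mult_less_iff)
  have "1 * K \<le> (of_nat N + 1/2) * K" "1 * K' \<le> (of_nat N + 1/2) * K'"
    using N K by (intro mult_right_mono; simp)+
  then have u_in: "u \<in> box (- b) b" "- u \<in> box (- b) b" using u by (auto simp: in_b)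
  have b_sub: "box (- b) b \<subseteq> cbox (- b) b" by (rule box_subset_cbox)
  have cb_sub: "cbox (- b) b \<subseteq> A"
  proof
    fix w assume "w \<in> cbox (- b) b"
    then have "\<bar>Re w\<bar> \<le> (of_nat N + 1/2) * K \<and> \<bar>Im w\<bar> \<le> (of_nat N + 1/2) * K'"
      by (auto simp: b_def in_cbox_complex_iff)
    moreover have "(of_nat N + 1/2) * K < (of_nat N + 3/4) * K" "(of_nat N + 1/2) * K' < (of_nat N + 3/4) * K'"
      using K by (intro mult_strict_right_mono; simp)+
    ultimately show "w \<in> A" unfolding in_A by linarith
  qed
  have fin: "finite pts" by (simp add: pts_def finite_odd_square)
  have pts_in: "pts \<subseteq> box (- b) b"
    using u_in L_in by (auto simp: pts_def odd_square_def)
  \<comment> \<open>Neither u nor -u can be a pole of \<open>G\<close>: the only lattice point so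
    close to the origin is the origin itself, whose coordinate sum is even.\<close>
  have "L (n, m) \<noteq> u \<and> L (n, m) \<noteq> - u" if "odd (n + m)" for n m
  proof -
    have "n = 0 \<and> m = 0" if "L (n, m) = u \<or> L (n, m) = - u"
    proof -
      have "\<bar>of_int n * K\<bar> < 1 * K" "\<bar>of_int m * K'\<bar> < 1 * K'"
        using u that by (auto simp: L_def lattice_point_def complex_eq_iff)
      then have "\<bar>real_of_int n\<bar> < 1" "\<bar>real_of_int m\<bar> < 1" using K by (simp_all only: abs_mult mult_less_cancel_right_pos abs_of_pos)
      then show ?thesis by auto
    qed
    with that show ?thesis by auto
  qed
  then have L_ne: "L p \<noteq> u" "L p \<noteq> - u" if "odd (fst p + snd p)" for p
    using that by (cases p; auto)+
  have sq: "w\<^sup>2 - u\<^sup>2 = (w - u) * (w + u)" for w by (simp add: power2_eq_square algebra_simps)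
  define R where "R = - {L (n, m) | n m. odd (n + m)}"
  have G_holo: "G holomorphic_on R" using holo by (simp add: R_def L_def)
  have A_R: "A - L ` odd_square N \<subseteq> R"
    using L_in by (auto simp: R_def odd_square_def)
  have \<Phi>_holo: "\<Phi> holomorphic_on A - pts"
    unfolding \<Phi>_def using A_R
    by (intro holomorphic_intros holomorphic_on_subset[OF G_holo]) (auto simp: power2_eq_iff pts_def)
  have "open A" by (simp add: A_def open_box)
  have open': "open (A - (pts - {p}))" for p
    using fin \<open>open A\<close> by (intro open_Diff finite_imp_closed) auto
  have residue: "residue \<Phi> p = r" if "p \<in> pts" "((\<lambda>w. \<Phi> w * (w - p)) \<longlongrightarrow> r) (at p)" for p r
  proof (rule residue_simple'[OF open' _ _ that(2)])
    show "p \<in> A - (pts - {p})" using that(1) pts_in b_sub cb_sub by auto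
    have "A - (pts - {p}) - {p} = A - pts" using that(1) by auto
    then show "\<Phi> holomorphic_on A - (pts - {p}) - {p}" using \<Phi>_holo by simp
  qed
  have res_L: "residue \<Phi> (L p) = \<rho> p * (2 * u / ((L p)\<^sup>2 - u\<^sup>2))" if p: "p \<in> odd_square N" for p
  proof (rule residue)
    have odd: "odd (fst p + snd p)" using p by (auto simp: odd_square_def)
    show "L p \<in> pts" using p by (simp add: pts_def)
    have "((\<lambda>w. (G w * (w - L p)) * (2 * u / (w\<^sup>2 - u\<^sup>2))) \<longlongrightarrow> \<rho> p * (2 * u / ((L p)\<^sup>2 - u\<^sup>2))) (at (L p))"
      using res[of "fst p" "snd p"] odd L_ne[OF odd] by (intro tendsto_intros) (auto simp: L_def power2_eq_iff)
    then show "((\<lambda>w. \<Phi> w * (w - L p)) \<longlongrightarrow> \<rho> p * (2 * u / ((L p)\<^sup>2 - u\<^sup>2))) (at (L p))"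
      by (simp add: \<Phi>_def mult_ac)
  qed
  have G_cont: "G \<midarrow>p\<rightarrow> G p" if "p \<in> A - L ` odd_square N" for p
  proof -
    have "open (A - L ` odd_square N)"
      using \<open>open A\<close> finite_odd_square by (intro open_Diff finite_imp_closed) auto
    moreover have "continuous_on (A - L ` odd_square N) G"
      using holomorphic_on_subset[OF G_holo A_R] holomorphic_on_imp_continuous_on by blast
    ultimately show ?thesis using that continuous_on_eq_continuous_at isCont_def by blast
  qed
  have "odd (fst p + snd p)" if "p \<in> odd_square N" for p using that by (auto simp: odd_square_def)
  then have not_L: "u \<notin> L ` odd_square N" "- u \<notin> L ` odd_square N"
    using L_ne by (metis imageE)+
  then have u_nL: "u \<in> A - L ` odd_square N" "- u \<in> A - L ` odd_square N"
    using u_in b_sub cb_sub by auto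
  have res_u: "residue \<Phi> u = G u"
  proof (rule residue)
    have "((\<lambda>w. G w * (2 * u / (w + u))) \<longlongrightarrow> G u * (2 * u / (u + u))) (at u)"
      using u by (intro tendsto_intros G_cont u_nL) auto
    then have "((\<lambda>w. G w * (2 * u / (w + u))) \<longlongrightarrow> G u) (at u)" using u by simp
    then show "((\<lambda>w. \<Phi> w * (w - u)) \<longlongrightarrow> G u) (at u)"
      by (rule Lim_transform_eventually)
        (auto simp: \<Phi>_def sq eventually_at_filter intro!: always_eventually)
  qed (simp add: pts_def)
  have res_mu: "residue \<Phi> (- u) = G u"
  proof (rule residue)
    have "((\<lambda>w. G w * (2 * u / (w - u))) \<longlongrightarrow> G (- u) * (2 * u / (- u - u))) (at (- u))"
      using u by (intro tendsto_intros G_cont u_nL) auto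
    moreover have "G (- u) * (2 * u / (- u - u)) = G u" using u by (simp add: G_minus field_simps)
    ultimately have "((\<lambda>w. G w * (2 * u / (w - u))) \<longlongrightarrow> G u) (at (- u))" by simp
    then show "((\<lambda>w. \<Phi> w * (w - - u)) \<longlongrightarrow> G u) (at (- u))"
      by (rule Lim_transform_eventually)
        (auto simp: \<Phi>_def sq eventually_at_filter add_eq_0_iff2 intro!: always_eventually)
  qed (simp add: pts_def)
  have b_le: "Re (- b) \<le> Re b" "Im (- b) \<le> Im b" using K by (auto simp: b_def)
  have path: "path_image (rectpath (- b) b) \<subseteq> A - pts"
    unfolding path_image_rectpath_cbox_minus_box[OF b_le] using cb_sub pts_in by blast
  have "contour_integral (rectpath (- b) b) \<Phi> =
      2 * pi * \<i> * (\<Sum>p\<in>pts. winding_number (rectpath (- b) b) p * residue \<Phi> p)"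
  proof (rule Residue_theorem[OF \<open>open A\<close> _ fin \<Phi>_holo _ _ path])
    show "connected A" unfolding A_def by (rule convex_connected) (rule convex_box)
    show "\<forall>z. z \<notin> A \<longrightarrow> winding_number (rectpath (- b) b) z = 0"
      using winding_number_rectpath_outside[OF b_le] cb_sub by blast
  qed auto
  also have "(\<Sum>p\<in>pts. winding_number (rectpath (- b) b) p * residue \<Phi> p) = (\<Sum>p\<in>pts. residue \<Phi> p)"
    using pts_in by (intro sum.cong) (auto simp: winding_number_rectpath)
  also have "\<dots> = (\<Sum>p\<in>L ` odd_square N. residue \<Phi> p) + (\<Sum>p\<in>{u, - u}. residue \<Phi> p)"
    unfolding pts_def using not_L finite_odd_square by (intro sum.union_disjoint) auto
  also have "(\<Sum>p\<in>{u, - u}. residue \<Phi> p) = 2 * G u" using u by (simp add: res_u res_mu)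
  also have "(\<Sum>p\<in>L ` odd_square N. residue \<Phi> p) = (\<Sum>p\<in>odd_square N. residue \<Phi> (L p))"
    using lattice_point_inj[of K K'] K by (intro sum.reindex_cong[of L]) (auto simp: L_def intro: inj_on_subset)
  also have "\<dots> = (\<Sum>p\<in>odd_square N. \<rho> p * (2 * u / ((L p)\<^sup>2 - u\<^sup>2)))"
    by (intro sum.cong refl res_L)
  finally show "contour_integral (rectpath (- b) b) \<Phi> =
      2 * pi * \<i> * ((\<Sum>p\<in>odd_square N. \<rho> p * (2 * u / ((lattice_point K K' p)\<^sup>2 - u\<^sup>2))) + 2 * G u)"
    unfolding L_def .
  show "\<Phi> contour_integrable_on (rectpath (- b) b)"
    by (rule contour_integrable_holomorphic_simple[OF \<Phi>_holo _ _ path])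
      (use \<open>open A\<close> fin in \<open>auto intro: open_Diff finite_imp_closed\<close>)
qed

text \<open>On the N-th rectangle \<open>G\<close> is bounded, the kernel is of order N^-2 and the
  perimeter of order N, so the boundary integral tends to 0. The factor 2 in front of both
  \<open>G u\<close> and the sum comes from the two poles u and -u and from the numerator 2
  u.\<close>

lemma square_sums_tendsto:
  assumes u: "u \<noteq> 0" "\<bar>Re u\<bar> < K" "\<bar>Im u\<bar> < K'"
  shows "(\<lambda>N. \<Sum>p\<in>odd_square N. \<rho> p * (u / (u\<^sup>2 - (lattice_point K K' p)\<^sup>2))) \<longlonglongrightarrow> G u"
proof -
  define \<Phi> where "\<Phi> w = G w * (2 * u / (w\<^sup>2 - u\<^sup>2))" for w
  define b where "b N = Complex ((of_nat N + 1/2) * K) ((of_nat N + 1/2) * K')" for N :: nat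
  define I where "I N = contour_integral (rectpath (- b N) (b N)) \<Phi>" for N
  define T where "T N = (\<Sum>p\<in>odd_square N. \<rho> p * (u / (u\<^sup>2 - (lattice_point K K' p)\<^sup>2)))" for N
  obtain B where B: "\<And>w j. Re w = (of_int j + 1/2) * K \<or> Im w = (of_int j + 1/2) * K' \<Longrightarrow> norm (G w) \<le> B"
    using bound by blast
  have "B \<ge> 0" using order_trans[OF norm_ge_zero B[of "Complex ((of_int 0 + 1/2) * K) 0" 0]] by simp
  define \<kappa> where "\<kappa> = min K K'"
  have \<kappa>: "\<kappa> > 0" using K by (simp add: \<kappa>_def)
  \<comment> \<open>Bound for \<open>G\<close>, times bound for the kernel (points of the contour
    have modulus at least (N + 1/2) \<kappa>), times perimeter.\<close>
  define E where "E N = B * (2 * norm u / (((of_nat N + 1/2) * \<kappa>)\<^sup>2 - (norm u)\<^sup>2)) *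
     (4 * (of_nat N + 1/2) * (K + K'))" for N :: nat
  have I_eq: "I N = 2 * pi * \<i> * (2 * G u - 2 * T N)" if "1 \<le> N" for N
  proof -
    have "(\<Sum>p\<in>odd_square N. \<rho> p * (2 * u / ((lattice_point K K' p)\<^sup>2 - u\<^sup>2))) = - (2 * T N)"
      unfolding T_def sum_distrib_left sum_negf[symmetric]
    proof (rule sum.cong)
      fix p
      have "(lattice_point K K' p)\<^sup>2 - u\<^sup>2 = - (u\<^sup>2 - (lattice_point K K' p)\<^sup>2)" by simp
      then show "\<rho> p * (2 * u / ((lattice_point K K' p)\<^sup>2 - u\<^sup>2)) = - (2 * (\<rho> p * (u / (u\<^sup>2 - (lattice_point K K' p)\<^sup>2))))"
        by (simp only: divide_minus_right) simp
    qed simp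
    then show ?thesis
      using residue_sum(1)[OF u that] unfolding I_def b_def \<Phi>_def by simp
  qed
  have I_bound: "norm (I N) \<le> E N" if N: "1 \<le> N" "norm u < (of_nat N + 1/2) * \<kappa>" for N
  proof -
    have pos: "0 < ((of_nat N + 1/2) * \<kappa>)\<^sup>2 - (norm u)\<^sup>2"
      using N by (simp add: power_strict_mono)
    have "norm (\<Phi> w) \<le> B * (2 * norm u / (((of_nat N + 1/2) * \<kappa>)\<^sup>2 - (norm u)\<^sup>2))"
      if "w \<in> path_image (rectpath (- b N) (b N))" for w
    proof -
      have le: "Re (- b N) \<le> Re (b N)" "Im (- b N) \<le> Im (b N)" using K by (auto simp: b_def)
      have "Re (- b N) = (of_int (- int N - 1) + 1/2) * K" "Re (b N) = (of_int (int N) + 1/2) * K"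
        "Im (- b N) = (of_int (- int N - 1) + 1/2) * K'" "Im (b N) = (of_int (int N) + 1/2) * K'"
        by (simp_all add: b_def algebra_simps)
      moreover have "Re w = Re (- b N) \<or> Re w = Re (b N) \<or> Im w = Im (- b N) \<or> Im w = Im (b N)"
        using that unfolding path_image_rectpath[OF le] by blast
      ultimately have "\<exists>j. Re w = (of_int j + 1/2) * K \<or> Im w = (of_int j + 1/2) * K'"
        by metis
      then have G: "norm (G w) \<le> B" using B by blast
      have "\<bar>Re w\<bar> = (of_nat N + 1/2) * K \<or> \<bar>Im w\<bar> = (of_nat N + 1/2) * K'"
        using that K unfolding path_image_rectpath[OF le] by (auto simp: b_def)
      moreover have "(of_nat N + 1/2) * \<kappa> \<le> (of_nat N + 1/2) * K" "(of_nat N + 1/2) * \<kappa> \<le> (of_nat N + 1/2) * K'"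
        by (auto simp: \<kappa>_def intro!: mult_left_mono)
      ultimately have "(of_nat N + 1/2) * \<kappa> \<le> norm w"
        using abs_Re_le_cmod[of w] abs_Im_le_cmod[of w] by linarith
      then have "((of_nat N + 1/2) * \<kappa>)\<^sup>2 - (norm u)\<^sup>2 \<le> (norm w)\<^sup>2 - (norm u)\<^sup>2"
        using \<kappa> by (simp add: power_mono)
      also have "\<dots> \<le> norm (w\<^sup>2 - u\<^sup>2)"
        using norm_triangle_ineq2[of "w\<^sup>2" "u\<^sup>2"] by (simp add: norm_power)
      finally have "norm (2 * u / (w\<^sup>2 - u\<^sup>2)) \<le> 2 * norm u / (((of_nat N + 1/2) * \<kappa>)\<^sup>2 - (norm u)\<^sup>2)"
        using pos unfolding norm_divide norm_mult by (intro frac_le) auto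
      then show ?thesis
        unfolding \<Phi>_def norm_mult[of "G w"] using G \<open>B \<ge> 0\<close> by (intro mult_mono) auto
    qed
    then have "norm (I N) \<le> B * (2 * norm u / (((of_nat N + 1/2) * \<kappa>)\<^sup>2 - (norm u)\<^sup>2)) *
        (2 * (Re (b N) - Re (- b N)) + 2 * (Im (b N) - Im (- b N)))"
      unfolding I_def using \<open>B \<ge> 0\<close> K pos residue_sum(2)[OF u N(1)]
      by (intro contour_integral_rectpath_bound) (auto simp: b_def \<Phi>_def[abs_def])
    then show ?thesis by (simp add: E_def b_def algebra_simps)
  qed
  have "E \<longlonglongrightarrow> 0"
    unfolding E_def using \<kappa> by real_asymp
  moreover have "\<forall>\<^sub>F N in sequentially. norm u < (of_nat N + 1/2) * \<kappa>"
    using \<kappa> by real_asymp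
  then have "\<forall>\<^sub>F N in sequentially. norm (I N) \<le> E N"
    using eventually_ge_at_top[of 1] by eventually_elim (use I_bound in auto)
  ultimately have "I \<longlonglongrightarrow> 0" by (rule Lim_null_comparison[rotated])
  then have "(\<lambda>N. G u - I N / (4 * pi * \<i>)) \<longlonglongrightarrow> G u - 0 / (4 * pi * \<i>)"
    by (intro tendsto_intros) auto
  moreover have "\<forall>\<^sub>F N in sequentially. G u - I N / (4 * pi * \<i>) = T N"
    using eventually_ge_at_top[of 1] by eventually_elim (auto simp: I_eq field_simps)
  ultimately show ?thesis
    unfolding T_def[abs_def, symmetric] by (simp add: tendsto_cong)
qed

end

section \<open>The partial fraction expansion of sn / cd\<close>

context jacobi_pair
begin

definition G where "G z = sn z * dn z / cn z"

definition \<rho> :: "int \<times> int \<Rightarrow> complex" where "\<rho> = (\<lambda>(n, m). if even n then 1 else -1)"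

lemma sn_cn_dn_sq:
  assumes "W z \<noteq> 0"
  shows "(sn z)\<^sup>2 = 1 - (cn z)\<^sup>2" "(dn z)\<^sup>2 = 1 - q + q * (cn z)\<^sup>2"
proof -
  have i: "\<i>\<^sup>2 = -1" by simp
  have "(num_sn z)\<^sup>2 = (W z)\<^sup>2 - (num_cn z)\<^sup>2" "(num_dn z)\<^sup>2 = (1 - q) * (W z)\<^sup>2 + q * (num_cn z)\<^sup>2"
    unfolding W_def num_sn_def num_cn_def num_dn_def using rels[of z] i by algebra+
  then show "(sn z)\<^sup>2 = 1 - (cn z)\<^sup>2" "(dn z)\<^sup>2 = 1 - q + q * (cn z)\<^sup>2"
    using assms by (simp_all add: sn_def cn_def dn_def power_divide field_simps)
qed

lemma q_ne: "q \<noteq> 0" "q \<noteq> 1"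
proof -
  have "k\<^sup>2 < 1" using jac by (auto simp: real_jacobi_def power_less_one_iff)
  then have "k\<^sup>2 \<noteq> 0" "k\<^sup>2 \<noteq> 1" using k_pos by auto
  then show "q \<noteq> 0" "q \<noteq> 1" by (metis of_real_power of_real_eq_0_iff of_real_eq_1_iff)+
qed

text \<open>The squared modulus of the numerator is a sum of two nonnegative terms, so both vanish.
  Of the combinations this allows, s = c' = 0 is a zero of \<open>W\<close> and the mixed ones
  contradict s^2 + c^2 = 1 or its primed version.\<close>

lemma cn_eq_0:
  assumes "W z \<noteq> 0" "cn z = 0"
  shows "c (Re z) = 0" "s' (Im z) = 0"
proof -
  have "(norm (num_cn z))\<^sup>2 = 0" using assms by (simp add: cn_def)
  then have "((d (Re z))\<^sup>2 * (s' (Im z))\<^sup>2 * (d' (Im z))\<^sup>2) * (s (Re z))\<^sup>2 = 0 \<and>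
    (c (Re z))\<^sup>2 * (c' (Im z))\<^sup>2 = 0"
    unfolding norm_num_cn by (subst (asm) add_nonneg_eq_0_iff) auto
  then have "s' (Im z) = 0 \<or> s (Re z) = 0" "c (Re z) = 0 \<or> c' (Im z) = 0"
    using real_sq(3)[of "Re z"] real_sq(6)[of "Im z"] by auto
  moreover have "\<not> (s' (Im z) = 0 \<and> c' (Im z) = 0)" "\<not> (s (Re z) = 0 \<and> c (Re z) = 0)"
    using real_sq(1)[of "Re z"] real_sq(4)[of "Im z"] by auto
  ultimately show "c (Re z) = 0" "s' (Im z) = 0"
    using assms(1) unfolding W_eq_0_iff' by auto
qed

lemma regular:
  assumes "\<And>n m. odd (n + m) \<Longrightarrow> z \<noteq> lattice_point K K' (n, m)"
  shows "W z \<noteq> 0" "cn z \<noteq> 0"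
proof -
  show W: "W z \<noteq> 0"
  proof
    assume "W z = 0"
    then obtain m n :: int where "z = Complex (2 * of_int m * K) ((2 * of_int n + 1) * K')"
      using W_eq_0_iff by blast
    then show False using assms[of "2 * m" "2 * n + 1"] by (simp add: lattice_point_def)
  qed
  show "cn z \<noteq> 0"
  proof
    assume "cn z = 0"
    from cn_eq_0[OF W this] obtain n m :: int
      where "Re z = (2 * of_int n + 1) * K" "Im z = 2 * of_int m * K'"
      using jac jac' by (auto simp: real_jacobi_def)
    then show False using assms[of "2 * n + 1" "2 * m"] by (simp add: lattice_point_def complex_eq_iff)
  qed
qed

lemma G_deriv:
  assumes "W z \<noteq> 0" "cn z \<noteq> 0" shows "\<exists>D. (G has_field_derivative D) (at z)"
  unfolding G_def[abs_def]
  by (rule exI) (rule DERIV_divide DERIV_mult sn_deriv cn_deriv dn_deriv assms)+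

section \<open>Parity and periods of sn / cd\<close>

lemma parts_minus:
  "S (- z) = - S z" "C (- z) = C z" "D (- z) = D z" "S' (- z) = - S' z" "C' (- z) = C' z" "D' (- z) = D' z"
  using jac jac' by (auto simp: S_def C_def D_def S'_def C'_def D'_def real_jacobi_def)

lemma G_minus: "G (- z) = - G z"
proof -
  have "num_sn (- z) = - num_sn z" "num_cn (- z) = num_cn z" "num_dn (- z) = num_dn z" "W (- z) = W z"
    unfolding num_sn_def num_cn_def num_dn_def W_def parts_minus by simp_all
  then show ?thesis by (simp add: G_def sn_def cn_def dn_def)
qed

text \<open>Under the shift by 2 K both sn and cn change sign, under the shift by 2 i K' both cn and
  dn do; in \<open>G\<close> the signs cancel.\<close>

lemma G_real_period: "G (z + of_real (2 * K)) = G z"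
proof -
  have 1: "S (z + of_real (2 * K)) = - S z" "C (z + of_real (2 * K)) = - C z" "D (z + of_real (2 * K)) = D z"
    "S' (z + of_real (2 * K)) = S' z" "C' (z + of_real (2 * K)) = C' z" "D' (z + of_real (2 * K)) = D' z"
    using jac by (auto simp: S_def C_def D_def S'_def C'_def D'_def real_jacobi_def)
  have "num_sn (z + of_real (2 * K)) = - num_sn z" "num_cn (z + of_real (2 * K)) = - num_cn z"
    "num_dn (z + of_real (2 * K)) = num_dn z" "W (z + of_real (2 * K)) = W z"
    unfolding num_sn_def num_cn_def num_dn_def W_def 1 by simp_all
  then show ?thesis by (simp add: G_def sn_def cn_def dn_def)
qed

lemma G_imag_period: "G (z + \<i> * of_real (2 * K')) = G z"
proof -
  have 1: "S (z + \<i> * of_real (2 * K')) = S z" "C (z + \<i> * of_real (2 * K')) = C z"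
    "D (z + \<i> * of_real (2 * K')) = D z" "S' (z + \<i> * of_real (2 * K')) = - S' z"
    "C' (z + \<i> * of_real (2 * K')) = - C' z" "D' (z + \<i> * of_real (2 * K')) = D' z"
    using jac' by (auto simp: S_def C_def D_def S'_def C'_def D'_def real_jacobi_def)
  have "num_sn (z + \<i> * of_real (2 * K')) = num_sn z" "num_cn (z + \<i> * of_real (2 * K')) = - num_cn z"
    "num_dn (z + \<i> * of_real (2 * K')) = - num_dn z" "W (z + \<i> * of_real (2 * K')) = W z"
    unfolding num_sn_def num_cn_def num_dn_def W_def 1 by simp_all
  then show ?thesis by (simp add: G_def sn_def cn_def dn_def)
qed

lemma G_periods: "G (z + of_real (of_int n * (2 * K)) + \<i> * of_real (of_int m * (2 * K'))) = G z"
proof -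
  have 1: "G (w + of_real (of_int n * (2 * K))) = G w" for w and n :: int
  proof (induction n rule: int_induct[where k = 0])
    case (step1 i) then show ?case
      using G_real_period[of "w + of_real (of_int i * (2 * K))"] by (simp add: algebra_simps)
  next
    case (step2 i) then show ?case
      using G_real_period[of "w + of_real (of_int (i - 1) * (2 * K))"] by (simp add: algebra_simps)
  qed simp
  have "G (w + \<i> * of_real (of_int m * (2 * K'))) = G w" for w and m :: int
  proof (induction m rule: int_induct[where k = 0])
    case (step1 i) then show ?case
      using G_imag_period[of "w + \<i> * of_real (of_int i * (2 * K'))"] by (simp add: algebra_simps)
  next
    case (step2 i) then show ?case
      using G_imag_period[of "w + \<i> * of_real (of_int (i - 1) * (2 * K'))"] by (simp add: algebra_simps)
  qed simp
  with 1 show ?thesis by simp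
qed

section \<open>Residues of sn / cd\<close>

text \<open>A logarithmic derivative at a simple zero: \<open>G\<close> is - cn' / cn, and at p the
  squares of sn and dn are 1 and 1 - k^2, so cn' does not vanish.\<close>

lemma residue_at_zero_of_cn:
  assumes "W p \<noteq> 0" "cn p = 0"
  shows "((\<lambda>w. G w * (w - p)) \<longlongrightarrow> - 1) (at p)"
proof -
  have "(sn p)\<^sup>2 = 1" "(dn p)\<^sup>2 = 1 - q" using sn_cn_dn_sq[OF assms(1)] assms(2) by simp_all
  then have ne: "sn p \<noteq> 0" "dn p \<noteq> 0" using q_ne by auto
  have "((\<lambda>w. (cn w - cn p) / (w - p)) \<longlongrightarrow> - (sn p * dn p)) (at p)"
    using cn_deriv[OF assms(1)] by (simp add: has_field_derivative_iff)
  moreover have "isCont sn p" "isCont dn p"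
    using sn_deriv[OF assms(1)] dn_deriv[OF assms(1)] DERIV_isCont by blast+
  ultimately have "((\<lambda>w. sn w * dn w / ((cn w - cn p) / (w - p))) \<longlongrightarrow> sn p * dn p / - (sn p * dn p)) (at p)"
    using ne by (intro tendsto_intros) (auto simp: isCont_def)
  then show ?thesis using assms ne by (simp add: G_def)
qed

text \<open>\<open>h = 1 / cn\<close> satisfies \<open>h'\<^sup>2 = (h\<^sup>2 - 1) ((1 - k\<^sup>2) h\<^sup>2 + k\<^sup>2)\<close>, so at a pole of \<open>cn\<close> it has a
  zero with \<open>h'\<^sup>2 = - k\<^sup>2 \<noteq> 0\<close>, and \<open>G = h' / h\<close>.\<close>

lemma residue_at_pole_of_cn:
  assumes "W p = 0"
  shows "((\<lambda>w. G w * (w - p)) \<longlongrightarrow> 1) (at p)"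
proof -
  define h where "h w = inverse (cn w)" for w
  have cn_pole: "is_pole cn p" using assms is_pole_cn by blast
  \<comment> \<open>At the pole cn takes the default value 0 and so does its inverse, which agrees
    with the limit of \<open>h\<close> there.\<close>
  have h_0: "h p = 0" using assms by (simp add: h_def cn_def)
  have h_lim: "h \<midarrow>p\<rightarrow> 0"
    unfolding h_def using cn_pole is_pole_def filterlim_inverse_at_iff[of cn "at p"] filterlim_at by blast
  then have "\<not> is_pole h p"
    unfolding is_pole_def using not_tendsto_and_filterlim_at_infinity[of "at p"] by auto
  moreover have "h nicely_meromorphic_on UNIV"
    unfolding h_def by (rule nicely_meromorphic_on_inverse[OF cn_meromorphic])
  ultimately have h_an: "h analytic_on {p}" by (intro nicely_meromorphic_on_imp_analytic_at) auto
  then obtain r where "r > 0" and h_holo: "h holomorphic_on ball p r" by (auto simp: analytic_on_def)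
  have h_deriv: "(h has_field_derivative deriv h p) (at p)"
    using h_holo \<open>r > 0\<close> by (intro holomorphic_derivI[of h "ball p r"]) auto
  have deriv_lim: "deriv h \<midarrow>p\<rightarrow> deriv h p"
    using holomorphic_on_imp_continuous_on[OF holomorphic_deriv[OF h_holo open_ball]] \<open>r > 0\<close>
    by (simp add: continuous_on_eq_continuous_at isCont_def[symmetric])
  have "\<forall>\<^sub>F w in at p. cn w \<noteq> 0" using non_zero_neighbour_pole[OF cn_pole] .
  then have ev: "\<forall>\<^sub>F w in at p. W w \<noteq> 0 \<and> cn w \<noteq> 0" using W_isolated by eventually_elim simp
  have ev_deriv: "\<forall>\<^sub>F w in at p. deriv h w = sn w * dn w * (h w)\<^sup>2 \<and> W w \<noteq> 0 \<and> cn w \<noteq> 0"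
    using ev
  proof eventually_elim
    case (elim w)
    have "(h has_field_derivative - (inverse (cn w) * - (sn w * dn w) * inverse (cn w))) (at w)"
      unfolding h_def[abs_def] using elim by (intro DERIV_inverse' cn_deriv) auto
    from DERIV_imp_deriv[OF this] elim show ?case by (simp add: h_def power2_eq_square mult_ac)
  qed
  have "\<forall>\<^sub>F w in at p. (deriv h w)\<^sup>2 = ((h w)\<^sup>2 - 1) * ((1 - q) * (h w)\<^sup>2 + q)"
    using ev_deriv
  proof eventually_elim
    case (elim w)
    then have "(deriv h w)\<^sup>2 = (sn w)\<^sup>2 * (dn w)\<^sup>2 * (h w)\<^sup>2 * (h w)\<^sup>2"
      by (simp add: power_mult_distrib power2_eq_square)
    also have "\<dots> = ((h w)\<^sup>2 - 1) * ((1 - q) * (h w)\<^sup>2 + q)"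
      using elim by (simp add: sn_cn_dn_sq h_def field_simps)
    finally show ?case .
  qed
  moreover have "((\<lambda>w. ((h w)\<^sup>2 - 1) * ((1 - q) * (h w)\<^sup>2 + q)) \<longlongrightarrow> (0\<^sup>2 - 1) * ((1 - q) * 0\<^sup>2 + q)) (at p)"
    by (intro tendsto_intros h_lim)
  ultimately have "((\<lambda>w. (deriv h w)\<^sup>2) \<longlongrightarrow> - q) (at p)" by (subst tendsto_cong) auto
  moreover have "((\<lambda>w. (deriv h w)\<^sup>2) \<longlongrightarrow> (deriv h p)\<^sup>2) (at p)" by (intro tendsto_intros deriv_lim)
  ultimately have "(deriv h p)\<^sup>2 = - q" using LIM_unique by blast
  then have ne: "deriv h p \<noteq> 0" using q_ne by auto
  have "((\<lambda>w. (h w - h p) / (w - p)) \<longlongrightarrow> deriv h p) (at p)"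
    using h_deriv by (simp add: has_field_derivative_iff)
  then have "((\<lambda>w. deriv h w / ((h w - h p) / (w - p))) \<longlongrightarrow> deriv h p / deriv h p) (at p)"
    by (intro tendsto_intros deriv_lim ne)
  moreover have "\<forall>\<^sub>F w in at p. deriv h w / ((h w - h p) / (w - p)) = G w * (w - p)"
    unfolding h_0 using ev_deriv by eventually_elim (simp add: G_def h_def field_simps power2_eq_square)
  ultimately show ?thesis using ne tendsto_cong by fastforce
qed

text \<open>Modulo the periods 2 K and 2 i K' the half-integer lines reduce to four segments, with
  Re w = K/2 or -K/2, or Im w = K'/2 or -K'/2. They form a compact set that avoids the lattice, so
  continuity of \<open>G\<close> gives the bound.\<close>

lemma norm_G_bounded_on_lines:
  "\<exists>B. \<forall>w. (\<exists>j::int. Re w = (of_int j + 1/2) * K \<or> Im w = (of_int j + 1/2) * K') \<longrightarrow> norm (G w) \<le> B"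
proof -
  define T where "T = {w. (Re w \<in> {K/2, - K/2} \<and> Im w \<in> {0..2 * K'}) \<or> (Re w \<in> {0..2 * K} \<and> Im w \<in> {K'/2, - K'/2})}"
  have T_eq: "T = (\<Union>x\<in>{K/2, - K/2}. cbox (Complex x 0) (Complex x (2 * K'))) \<union>
      (\<Union>y\<in>{K'/2, - K'/2}. cbox (Complex 0 y) (Complex (2 * K) y))"
    by (auto simp: T_def in_cbox_complex_iff)
  have "compact T"
    unfolding T_eq by (intro compact_Un compact_UN) auto
  have half: "of_int j * K \<noteq> K/2 \<and> of_int j * K \<noteq> - K/2" "of_int j * K' \<noteq> K'/2 \<and> of_int j * K' \<noteq> - K'/2" for j :: int
  proof -
    have "2 * j \<noteq> 1" "2 * j \<noteq> - 1" by presburger+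
    then have "of_int (2 * j) \<noteq> (1::real)" "of_int (2 * j) \<noteq> (- 1::real)" by linarith+
    then have "of_int j \<noteq> (1/2::real)" "of_int j \<noteq> - (1/2::real)" by auto
    then have "of_int j * L \<noteq> (1/2) * L" "of_int j * L \<noteq> (- (1/2)) * L" if "0 < L" for L :: real
      unfolding mult_cancel_right using that by auto
    then show "of_int j * K \<noteq> K/2 \<and> of_int j * K \<noteq> - K/2" "of_int j * K' \<noteq> K'/2 \<and> of_int j * K' \<noteq> - K'/2"
      using K_pos by auto
  qed
  have "isCont G w" if "w \<in> T" for w
  proof -
    have "w \<noteq> lattice_point K K' (n, m)" for n m
      using that half[of n] half[of m] by (auto simp: T_def lattice_point_def complex_eq_iff)
    then show ?thesis using regular[of w] G_deriv[of w] DERIV_isCont by blast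
  qed
  then have "continuous_on T G" by (simp add: continuous_at_imp_continuous_on)
  then have "bounded (G ` T)" using \<open>compact T\<close> by (intro compact_imp_bounded compact_continuous_image)
  then obtain B where B: "\<And>w. w \<in> T \<Longrightarrow> norm (G w) \<le> B" by (auto simp: bounded_iff)
  have reduce: "\<exists>n::int. x + of_int n * (2 * L) \<in> {0..2 * L}" if "0 < L" for x L :: real
  proof
    have "of_int \<lfloor>x / (2 * L)\<rfloor> * (2 * L) \<le> x" "x \<le> (of_int \<lfloor>x / (2 * L)\<rfloor> + 1) * (2 * L)"
      using that floor_divide_lower[of "2 * L" x] floor_divide_upper[of "2 * L" x] by (auto simp: less_imp_le)
    then show "x + of_int (- \<lfloor>x / (2 * L)\<rfloor>) * (2 * L) \<in> {0..2 * L}" by (auto simp: algebra_simps)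
  qed
  have reduce': "\<exists>n::int. (of_int j + 1/2) * L + of_int n * (2 * L) \<in> {L/2, - L/2}" for j :: int and L :: real
  proof (cases "even j")
    case True
    then obtain i where "j = 2 * i" by blast
    then show ?thesis by (intro exI[of _ "- i"]) (simp add: algebra_simps)
  next
    case False
    then obtain i where "j = 2 * i + 1" using oddE by blast
    then show ?thesis by (intro exI[of _ "- i - 1"]) (simp add: algebra_simps)
  qed
  have "norm (G w) \<le> B" if "Re w = (of_int j + 1/2) * K \<or> Im w = (of_int j + 1/2) * K'" for w and j :: int
  proof -
    have "\<exists>n m :: int. w + of_real (of_int n * (2 * K)) + \<i> * of_real (of_int m * (2 * K')) \<in> T"
      using that
    proof
      assume "Re w = (of_int j + 1/2) * K"
      then obtain n :: int where "Re w + of_int n * (2 * K) \<in> {K/2, - K/2}" using reduce' by metis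
      moreover obtain m :: int where "Im w + of_int m * (2 * K') \<in> {0..2 * K'}" using reduce K_pos by metis
      ultimately show ?thesis unfolding T_def by (intro exI[of _ n] exI[of _ m]) simp
    next
      assume "Im w = (of_int j + 1/2) * K'"
      then obtain m :: int where "Im w + of_int m * (2 * K') \<in> {K'/2, - K'/2}" using reduce' by metis
      moreover obtain n :: int where "Re w + of_int n * (2 * K) \<in> {0..2 * K}" using reduce K_pos by metis
      ultimately show ?thesis unfolding T_def by (intro exI[of _ n] exI[of _ m]) simp
    qed
    then show ?thesis using B G_periods by metis
  qed
  then show ?thesis by blast
qed

sublocale odd_lattice_function K K' G \<rho>
proof
  have "open {z. W z \<noteq> 0 \<and> cn z \<noteq> 0}"
  proof -
    have "continuous_on {z. W z \<noteq> 0} cn"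
      using cn_deriv DERIV_isCont by (intro continuous_at_imp_continuous_on) blast
    then have "open ({z. W z \<noteq> 0} \<inter> cn -` (- {0}))"
      by (rule continuous_open_preimage[OF _ open_W]) auto
    then show ?thesis by (simp add: vimage_def Collect_conj_eq[symmetric] Int_def)
  qed
  then have "G holomorphic_on {z. W z \<noteq> 0 \<and> cn z \<noteq> 0}"
    using G_deriv by (auto simp: holomorphic_on_open)
  then show "G holomorphic_on - {lattice_point K K' (n, m) | n m. odd (n + m)}"
    by (rule holomorphic_on_subset) (use regular in blast)
  fix n m :: int assume nm: "odd (n + m)"
  let ?p = "lattice_point K K' (n, m)"
  show "((\<lambda>w. G w * (w - ?p)) \<longlongrightarrow> \<rho> (n, m)) (at ?p)"
  proof (cases "even n")
    case True
    then obtain i j where "n = 2 * i" "m = 2 * j + 1" using nm by (metis evenE oddE odd_add)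
    then have "W ?p = 0" unfolding W_eq_0_iff by (intro exI[of _ i] exI[of _ j]) (simp add: lattice_point_def)
    from residue_at_pole_of_cn[OF this] show ?thesis using True by (simp add: \<rho>_def)
  next
    case False
    then obtain i j where ij: "n = 2 * i + 1" "m = 2 * j" using nm by (metis evenE oddE odd_add)
    have c0: "c (Re ?p) = 0"
      using jac ij by (auto simp: real_jacobi_def lattice_point_def intro!: exI[of _ i])
    have s0: "s' (Im ?p) = 0"
      using jac' ij by (auto simp: real_jacobi_def lattice_point_def intro!: exI[of _ j])
    have "W ?p \<noteq> 0" using c0 real_sq(1)[of "Re ?p"] by (auto simp: W_eq_0_iff')
    moreover have "cn ?p = 0" using c0 s0 by (simp add: cn_def num_cn_def C_def S'_def)
    ultimately show ?thesis using residue_at_zero_of_cn False by (simp add: \<rho>_def)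
  qed
qed (use K_pos G_minus norm_G_bounded_on_lines in auto)

end

section \<open>Expansion of the kernel and termwise integration\<close>

text \<open>Mean value inequality on the segment from 0 to w. The factor |w| will cancel the 1/z in
  \<open>kernel_sum_bound\<close>.\<close>

lemma norm_sin_le_mult_exp: "norm (sin w) \<le> norm w * exp \<bar>Im w\<bar>" for w :: complex
proof -
  have "norm (sin w - sin 0) \<le> exp \<bar>Im w\<bar> * norm (w - 0)"
  proof (rule field_differentiable_bound[of "closed_segment 0 w"])
    show "(sin has_field_derivative cos v) (at v within closed_segment 0 w)" for v
      by (auto intro!: derivative_eq_intros)
    show "norm (cos v) \<le> exp \<bar>Im w\<bar>" if v: "v \<in> closed_segment 0 w" for v
    proof -
      obtain t where t: "0 \<le> t" "t \<le> 1" "v = t *\<^sub>R w" using v by (auto simp: in_segment)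
      show ?thesis unfolding t(3) using t(1,2) by (intro cmod_cos_le_exp)
    qed
  qed auto
  then show ?thesis by (simp add: mult.commute)
qed

text \<open>The product of the geometric series in a and b is grouped by total degree m. The degree
  fixes the height (m + 1) K' of the corresponding lattice points, so truncation at M cuts the cone
  at height M K'.\<close>

definition kernel_sum :: "real \<Rightarrow> real \<Rightarrow> nat \<Rightarrow> real \<Rightarrow> complex" where
  "kernel_sum K K' M z = 2 * of_real (exp (- z * K')) *
     (\<Sum>m<M. \<Sum>j\<le>m. (- exp (of_real z * Complex (- K') K)) ^ j * (- exp (of_real z * Complex (- K') (- K))) ^ (m - j))"

lemma norm_exp_lt_1:
  assumes "0 < K'" "0 < z"
  shows "norm (- exp (complex_of_real z * Complex (- K') K)) = exp (- z * K')" "exp (- z * K') < 1"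
  using assms by (simp_all add: mult_pos_pos)

text \<open>With A = exp(i z K) and E = exp(z K') one has a = -A/E and b = -1/(A E), and cos + cosh
  factors as (E + A)(A E + 1) / (2 A E), that is, as E (1 - a)(1 - b) / 2.\<close>

lemma kernel_sum_tendsto:
  assumes "0 < K'" "0 < z"
  shows "(\<lambda>M. kernel_sum K K' M z) \<longlonglongrightarrow> 1 / (cos (of_real (z * K)) + cosh (of_real (z * K')))"
proof -
  define a where "a = - exp (complex_of_real z * Complex (- K') K)"
  define b where "b = - exp (complex_of_real z * Complex (- K') (- K))"
  have norm: "norm a < 1" "norm b < 1"
    using norm_exp_lt_1[OF assms] unfolding a_def b_def by metis+
  have "(\<lambda>m. \<Sum>j\<le>m. a ^ j * b ^ (m - j)) sums ((\<Sum>j. a ^ j) * (\<Sum>j. b ^ j))"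
    by (rule Cauchy_product_sums) (use norm in \<open>auto simp: norm_power intro!: summable_geometric\<close>)
  then have "(\<lambda>M. \<Sum>m<M. \<Sum>j\<le>m. a ^ j * b ^ (m - j)) \<longlonglongrightarrow> 1 / (1 - a) * (1 / (1 - b))"
    using norm by (simp add: suminf_geometric sums_def)
  then have lim: "(\<lambda>M. kernel_sum K K' M z) \<longlonglongrightarrow>
      2 * of_real (exp (- z * K')) * (1 / (1 - a) * (1 / (1 - b)))"
    unfolding kernel_sum_def a_def[symmetric] b_def[symmetric] by (intro tendsto_intros)
  define A where "A = exp (\<i> * of_real (z * K))"
  define E where "E = exp (complex_of_real (z * K'))"
  have ne: "A \<noteq> 0" "E \<noteq> 0" by (auto simp: A_def E_def)
  have arg: "of_real z * Complex (- K') K = \<i> * of_real (z * K) - of_real (z * K')"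
    "of_real z * Complex (- K') (- K) = - (\<i> * of_real (z * K)) - of_real (z * K')"
    by (auto simp: complex_eq_iff)
  have ab: "a = - (A / E)" "b = - (1 / (A * E))"
    unfolding a_def b_def arg exp_diff exp_minus A_def[symmetric] E_def[symmetric]
    by (simp_all add: field_simps)
  have e: "complex_of_real (exp (- z * K')) = 1 / E"
    unfolding E_def exp_of_real by (simp add: exp_minus field_simps)
  have cc: "cos (of_real (z * K)) + cosh (of_real (z * K')) = (A + 1 / A + E + 1 / E) / 2"
    by (simp add: cos_exp_eq cosh_def A_def E_def exp_minus field_simps scaleR_conv_of_real)
  have "1 - a \<noteq> 0" "1 - b \<noteq> 0" using norm by auto
  then have ne': "E + A \<noteq> 0" "A * E + 1 \<noteq> 0" using ne by (auto simp: ab field_simps add_eq_0_iff2)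
  have "(A + 1 / A + E + 1 / E) / 2 = (E + A) * (A * E + 1) / (2 * A * E)"
    using ne by (simp add: field_simps)
  moreover have "2 * (1 / E) * (1 / (1 - a) * (1 / (1 - b))) = 2 * A * E / ((E + A) * (A * E + 1))"
  proof -
    have "1 - a = (E + A) / E" "1 - b = (A * E + 1) / (A * E)" using ne by (simp_all add: ab field_simps)
    then show ?thesis using ne by simp
  qed
  ultimately have "2 * (1 / E) * (1 / (1 - a) * (1 / (1 - b))) = 1 / ((A + 1 / A + E + 1 / E) / 2)"
    by (simp only: divide_divide_eq_right mult_1)
  with lim show ?thesis unfolding e cc by (simp only:)
qed

text \<open>Degree m contributes m + 1 products of modulus x^m, where x = exp(-z K'), and these sum
  to at most (1 - x)^-2. This is of order z^-2 at the origin, so it serves only for z bounded away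
  from 0.\<close>

lemma kernel_sum_bound_far:
  assumes "0 < K'" "0 < z"
  shows "norm (kernel_sum K K' M z) \<le> 2 * exp (- z * K') / (1 - exp (- z * K'))\<^sup>2"
proof -
  define a where "a = - exp (complex_of_real z * Complex (- K') K)"
  define b where "b = - exp (complex_of_real z * Complex (- K') (- K))"
  define x where "x = exp (- z * K')"
  have norm: "norm a = x" "norm b = x" and x: "0 < x" "x < 1"
    using norm_exp_lt_1[OF assms] unfolding a_def b_def x_def by simp_all
  have "(\<lambda>m. of_nat (Suc m) * x ^ m) sums (1 / (1 - x)\<^sup>2)"
    using x by (intro geometric_deriv_sums) auto
  then have "(\<Sum>m<M. of_nat (Suc m) * x ^ m) \<le> 1 / (1 - x)\<^sup>2"
    using x by (metis (no_types, lifting) finite_lessThan less_imp_le mult_nonneg_nonneg of_nat_0_le_iff sum_le_suminf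
        sums_iff zero_le_power)
  moreover have "norm (\<Sum>m<M. \<Sum>j\<le>m. a ^ j * b ^ (m - j)) \<le> (\<Sum>m<M. of_nat (Suc m) * x ^ m)"
  proof (rule sum_norm_le)
    fix m
    have "norm (a ^ j * b ^ (m - j)) \<le> x ^ m" if "j \<in> {..m}" for j
      using that by (simp add: norm_mult norm_power norm flip: power_add)
    then have "norm (\<Sum>j\<le>m. a ^ j * b ^ (m - j)) \<le> (\<Sum>j\<le>m. x ^ m)" by (rule sum_norm_le)
    then show "norm (\<Sum>j\<le>m. a ^ j * b ^ (m - j)) \<le> of_nat (Suc m) * x ^ m" by simp
  qed
  ultimately have "norm (\<Sum>m<M. \<Sum>j\<le>m. a ^ j * b ^ (m - j)) \<le> 1 / (1 - x)\<^sup>2" by linarith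
  from mult_left_mono[OF this, of "2 * x"] show ?thesis
    unfolding kernel_sum_def a_def[symmetric] b_def[symmetric] x_def[symmetric]
    using x by (simp add: norm_mult)
qed

text \<open>For small \<open>z\<close> the inner sums are \<open>(a\<^sup>m\<^sup>+\<^sup>1 - b\<^sup>m\<^sup>+\<^sup>1) / (a - b)\<close>, whose partial sums stay bounded
  after multiplication by \<open>a - b\<close>, although each of them is of order \<open>m\<close> at \<open>z = 0\<close>.\<close>

lemma kernel_sum_bound_near:
  assumes "0 < K" "0 < K'" "0 < z" "z * K \<le> 1"
  shows "norm (kernel_sum K K' M z) \<le> 4 * exp (- z * K') / sin (z * K)"
proof -
  define a where "a = - exp (complex_of_real z * Complex (- K') K)"
  define b where "b = - exp (complex_of_real z * Complex (- K') (- K))"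
  define x where "x = exp (- z * K')"
  define T where "T = (\<Sum>m<M. \<Sum>j\<le>m. a ^ j * b ^ (m - j))"
  have norm: "norm a = x" "norm b = x" and x: "0 < x" "x < 1"
    using norm_exp_lt_1[OF assms(2,3)] unfolding a_def b_def x_def by simp_all
  have "0 < z * K" using assms by simp
  then have \<theta>: "0 < sin (z * K)" "0 < cos (z * K)"
    using assms(4) pi_gt3 by (auto intro!: sin_gt_zero cos_gt_zero)
  \<comment> \<open>The condition z K \<le> 1 places a and b in the left half-plane, where |1 - w|
    \<ge> 1. This bounds the finite geometric sums uniformly in M.\<close>
  have geom: "norm (\<Sum>m<M. w ^ Suc m) \<le> 2 * x" if "norm w = x" "Re w \<le> 0" for w
  proof -
    have "w \<noteq> 1" using that by auto
    have "1 \<le> norm (1 - w)" using complex_Re_le_cmod[of "1 - w"] that by simp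
    have "(\<Sum>m<M. w ^ Suc m) = w * ((1 - w ^ M) / (1 - w))"
      using \<open>w \<noteq> 1\<close> by (simp add: sum_gp_strict flip: sum_distrib_left)
    also have "norm \<dots> = x * (norm (1 - w ^ M) / norm (1 - w))" by (simp add: norm_mult norm_divide that)
    also have "\<dots> \<le> x * (2 / 1)"
    proof (intro mult_left_mono frac_le)
      have "norm (1 - w ^ M) \<le> 1 + x ^ M"
        using norm_triangle_ineq4[of 1 "w ^ M"] by (simp add: norm_power that)
      also have "x ^ M \<le> 1" using x by (simp add: power_le_one)
      finally show "norm (1 - w ^ M) \<le> 2" by simp
    qed (use x \<open>1 \<le> norm (1 - w)\<close> in auto)
    finally show ?thesis by simp
  qed
  have Re: "Re a \<le> 0" "Re b \<le> 0" using \<theta> by (auto simp: a_def b_def Re_exp)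
  have "(a - b) * T = (\<Sum>m<M. (a - b) * (\<Sum>j\<le>m. a ^ j * b ^ (m - j)))"
    unfolding T_def by (rule sum_distrib_left)
  also have "\<dots> = (\<Sum>m<M. a ^ Suc m - b ^ Suc m)"
    by (intro sum.cong refl) (simp add: diff_power_eq_sum lessThan_Suc_atMost del: power_Suc)
  also have "\<dots> = (\<Sum>m<M. a ^ Suc m) - (\<Sum>m<M. b ^ Suc m)" by (rule sum_subtractf)
  also have "norm \<dots> \<le> 2 * x + 2 * x"
    using geom[OF norm(1) Re(1)] geom[OF norm(2) Re(2)] norm_triangle_ineq4 order_trans add_mono by metis
  finally have 1: "norm (a - b) * norm T \<le> 4 * x" by (simp add: norm_mult)
  \<comment> \<open>The real parts of a and b agree, so passing to the imaginary part loses
    nothing.\<close>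
  have "2 * x * sin (z * K) = \<bar>Im (a - b)\<bar>"
    using \<theta> x by (simp add: a_def b_def Im_exp x_def abs_mult)
  also have "\<dots> \<le> norm (a - b)" by (rule abs_Im_le_cmod)
  finally have "2 * x * sin (z * K) * norm T \<le> norm (a - b) * norm T" by (rule mult_right_mono) simp
  with 1 have "(2 * x * norm T) * sin (z * K) \<le> 4 * x" by (simp add: mult_ac)
  then have "2 * x * norm T \<le> 4 * x / sin (z * K)" using \<theta> by (simp add: pos_le_divide_eq)
  then show ?thesis
    unfolding kernel_sum_def a_def[symmetric] b_def[symmetric] x_def[symmetric] T_def[symmetric]
    using x by (simp add: norm_mult)
qed

text \<open>Near 0 the bound with sin(z K) \<ge> z K / 2 gives the 1/z, farther out the absolute
  bound gives a constant. The factor exp(-z K') is kept because it has to outweigh the growth exp(z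
  |Im u|) of the sine.\<close>

lemma kernel_sum_bound:
  assumes "0 < K" "0 < K'"
  obtains B where "0 \<le> B" "\<And>M z. 0 < z \<Longrightarrow> norm (kernel_sum K K' M z) \<le> B * exp (- z * K') * (1 + 1 / z)"
proof -
  have "\<forall>\<^sub>F x::real in at_right 0. x / 2 \<le> sin x" by real_asymp
  then obtain \<delta> where "0 < \<delta>" and \<delta>: "\<And>x::real. 0 < x \<Longrightarrow> x < \<delta> \<Longrightarrow> x / 2 \<le> sin x"
    unfolding eventually_at_right_field by auto
  \<comment> \<open>The two regimes meet at \<open>r\<close>, chosen so that z \<le> r gives both z
    K \<le> 1 and z K < \<delta>. The constant 8 / K is 4 divided by K / 2.\<close>
  define r where "r = min (\<delta> / 2) 1 / K"
  have r: "0 < r" using \<open>0 < \<delta>\<close> assms by (simp add: r_def)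
  define B\<^sub>1 where "B\<^sub>1 = 8 / K"
  define B\<^sub>2 where "B\<^sub>2 = 2 / (1 - exp (- r * K'))\<^sup>2"
  have B: "0 \<le> B\<^sub>1" "0 \<le> B\<^sub>2" using assms by (auto simp: B\<^sub>1_def B\<^sub>2_def)
  have "norm (kernel_sum K K' M z) \<le> (B\<^sub>1 + B\<^sub>2) * exp (- z * K') * (1 + 1 / z)" if z: "0 < z" for M z
  proof (cases "z \<le> r")
    case True
    then have "z * K \<le> r * K" using assms by simp
    also have "r * K = min (\<delta> / 2) 1" using assms by (simp add: r_def)
    finally have zK: "z * K \<le> 1" "z * K < \<delta>" using \<open>0 < \<delta>\<close> by (auto simp: min_def split: if_splits)
    have "0 < z * K / 2" using z assms by simp
    moreover from this have "z * K / 2 \<le> sin (z * K)" using \<delta>[of "z * K"] zK by simp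
    ultimately have "4 * exp (- z * K') / sin (z * K) \<le> 4 * exp (- z * K') / (z * K / 2)"
      by (intro frac_le) auto
    also have "\<dots> = B\<^sub>1 * exp (- z * K') * (1 / z)" by (simp add: B\<^sub>1_def field_simps)
    also have "\<dots> \<le> (B\<^sub>1 + B\<^sub>2) * exp (- z * K') * (1 + 1 / z)"
      using B z by (intro mult_mono) auto
    finally show ?thesis using kernel_sum_bound_near[OF assms z zK(1)] order_trans by blast
  next
    case False
    have e: "exp (- z * K') \<le> exp (- r * K')" "exp (- r * K') < 1" using False assms r by auto
    then have "2 * exp (- z * K') / (1 - exp (- z * K'))\<^sup>2 \<le> 2 * exp (- z * K') / (1 - exp (- r * K'))\<^sup>2"
      by (intro divide_left_mono power_mono mult_pos_pos zero_less_power) auto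
    also have "\<dots> = B\<^sub>2 * exp (- z * K') * 1" by (simp add: B\<^sub>2_def)
    also have "\<dots> \<le> (B\<^sub>1 + B\<^sub>2) * exp (- z * K') * (1 + 1 / z)"
      using B z by (intro mult_mono) auto
    finally show ?thesis using kernel_sum_bound_far[OF assms(2) z] order_trans by blast
  qed
  then show ?thesis using B by (intro that[of "B\<^sub>1 + B\<^sub>2"]) auto
qed

section \<open>Integrals over the half line\<close>

lemma integrable_exp_sqrt:
  assumes "0 < \<eta>"
  shows "set_integrable lborel {0<..} (\<lambda>x. exp (- \<eta> * sqrt x) / sqrt x)"
proof -
  have "set_integrable lborel (einterval 0 \<infinity>) (\<lambda>x. exp (- \<eta> * sqrt x) / sqrt x)"
  proof (rule interval_integral_FTC_nonneg(1))
    show "((\<lambda>x. - (2 / \<eta>) * exp (- \<eta> * sqrt x)) has_real_derivative exp (- \<eta> * sqrt x) / sqrt x) (at x)"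
      if "0 < ereal x" for x
      using that assms by (auto intro!: derivative_eq_intros simp: field_simps)
    show "isCont (\<lambda>x. exp (- \<eta> * sqrt x) / sqrt x) x" if "0 < ereal x" for x
      using that by (auto intro!: continuous_intros)
    show "(((\<lambda>x. - (2 / \<eta>) * exp (- \<eta> * sqrt x)) \<circ> real_of_ereal) \<longlongrightarrow> - (2 / \<eta>)) (at_right 0)"
      unfolding zero_ereal_def ereal_tendsto_simps using assms by real_asymp
    show "(((\<lambda>x. - (2 / \<eta>) * exp (- \<eta> * sqrt x)) \<circ> real_of_ereal) \<longlongrightarrow> 0) (at_left \<infinity>)"
      unfolding ereal_tendsto_simps using assms by real_asymp
  qed auto
  moreover have "einterval 0 \<infinity> = {0<..}" by (auto simp: einterval_def)
  ultimately show ?thesis by simp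
qed

text \<open>With x = z^2 this is twice the Laplace transform of sin(z u) at \<alpha>. The strip
  condition makes exp(-z \<alpha>) dominate the sine, and it excludes \<alpha> = i u and \<alpha> =
  -i u, the zeros of the denominator.\<close>

lemma sin_exp_integral:
  fixes u \<alpha> :: complex
  assumes "\<bar>Im u\<bar> < Re \<alpha>"
  defines "f \<equiv> \<lambda>x. sin (of_real (sqrt x) * u) / of_real (sqrt x) * exp (- of_real (sqrt x) * \<alpha>)"
  shows "set_integrable lborel {0<..} f" and "(LINT x:{0<..}|lborel. f x) = 2 * u / (u\<^sup>2 + \<alpha>\<^sup>2)"
proof -
  have ivl: "einterval 0 \<infinity> = {0<..}" by (auto simp: einterval_def)
  define \<eta> where "\<eta> = Re \<alpha> - \<bar>Im u\<bar>"
  have \<eta>: "0 < \<eta>" using assms by (simp add: \<eta>_def)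
  have decay: "norm (exp (- of_real z * \<alpha>) * w) \<le> exp (- \<eta> * z)" if "norm w \<le> exp \<bar>Im (of_real z * u)\<bar>" "0 \<le> z" for z w
  proof -
    have "norm (exp (- of_real z * \<alpha>) * w) \<le> exp (- z * Re \<alpha>) * exp (z * \<bar>Im u\<bar>)"
      using that by (auto simp: norm_mult abs_mult intro!: mult_mono)
    also have "\<dots> = exp (- \<eta> * z)" by (simp add: \<eta>_def algebra_simps flip: exp_add)
    finally show ?thesis .
  qed
  have bound_sin: "norm (sin w) \<le> exp \<bar>Im w\<bar>" and bound_cos: "norm (cos w) \<le> exp \<bar>Im w\<bar>" for w :: complex
    using cmod_sin_le_exp[of 1 w] cmod_cos_le_exp[of 1 w] by simp_all
  have meas: "set_borel_measurable lborel {0<..} f"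
    unfolding set_borel_measurable_def f_def by measurable
  show int: "set_integrable lborel {0<..} f"
  proof (rule set_integrable_bound[OF integrable_exp_sqrt[OF \<eta>] meas])
    show "AE x in lborel. x \<in> {0<..} \<longrightarrow> norm (f x) \<le> norm (exp (- \<eta> * sqrt x) / sqrt x)"
    proof (intro AE_I2 impI)
      fix x :: real assume "x \<in> {0<..}"
      then have "norm (exp (- of_real (sqrt x) * \<alpha>) * sin (of_real (sqrt x) * u)) / sqrt x \<le> exp (- \<eta> * sqrt x) / sqrt x"
        by (intro divide_right_mono decay bound_sin) auto
      then show "norm (f x) \<le> norm (exp (- \<eta> * sqrt x) / sqrt x)"
        using \<open>x \<in> {0<..}\<close> by (simp add: f_def norm_mult norm_divide mult.commute)
    qed
  qed
  have ne: "u\<^sup>2 + \<alpha>\<^sup>2 \<noteq> 0"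
  proof
    assume "u\<^sup>2 + \<alpha>\<^sup>2 = 0"
    moreover have "u\<^sup>2 + \<alpha>\<^sup>2 = (\<alpha> - \<i> * u) * (\<alpha> + \<i> * u)" by (simp add: power2_eq_square algebra_simps)
    ultimately have "\<alpha> = \<i> * u \<or> \<alpha> = - (\<i> * u)" by (auto simp: add_eq_0_iff2)
    then show False using assms(1) by auto
  qed
  \<comment> \<open>A primitive of 2 sin(z u) exp(-z \<alpha>) in the complex variable z, normalised
    to vanish at infinity; composed with the square root it is a primitive of
    \<open>f\<close>.\<close>
  define H where "H z = - 2 * exp (- z * \<alpha>) * (\<alpha> * sin (z * u) + u * cos (z * u)) / (u\<^sup>2 + \<alpha>\<^sup>2)" for z
  have H_deriv: "(H has_field_derivative 2 * sin (z * u) * exp (- z * \<alpha>)) (at z)" for z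
  proof -
    have "(H has_field_derivative - 2 * (exp (- z * \<alpha>) * (- \<alpha>) * (\<alpha> * sin (z * u) + u * cos (z * u)) +
        exp (- z * \<alpha>) * (\<alpha> * (cos (z * u) * u) - u * (sin (z * u) * u))) / (u\<^sup>2 + \<alpha>\<^sup>2)) (at z)"
      unfolding H_def[abs_def]
      by (rule DERIV_cdivide) (auto intro!: derivative_eq_intros simp: algebra_simps)
    also have "- 2 * (exp (- z * \<alpha>) * (- \<alpha>) * (\<alpha> * sin (z * u) + u * cos (z * u)) +
        exp (- z * \<alpha>) * (\<alpha> * (cos (z * u) * u) - u * (sin (z * u) * u))) =
        2 * sin (z * u) * exp (- z * \<alpha>) * (u\<^sup>2 + \<alpha>\<^sup>2)"
      by (simp add: algebra_simps power2_eq_square)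
    finally show ?thesis using ne by simp
  qed
  have "(LBINT x=0..\<infinity>. f x) = 0 - H 0"
  proof (rule interval_integral_FTC_integrable[where F = "\<lambda>x. H (of_real (sqrt x))"])
    show "((\<lambda>x. H (of_real (sqrt x))) has_vector_derivative f x) (at x)" if "0 < ereal x" for x
    proof -
      have "((\<lambda>x. complex_of_real (sqrt x)) has_vector_derivative of_real (inverse (sqrt x) / 2)) (at x)"
        by (rule has_vector_derivative_of_real, rule DERIV_real_sqrt) (use that in simp)
      from field_vector_diff_chain_at[OF this H_deriv]
      show ?thesis by (simp add: o_def f_def field_simps)
    qed
    show "isCont f x" if "0 < ereal x" for x
      unfolding f_def using that by (auto intro!: continuous_intros)
    show "set_integrable lborel (einterval 0 \<infinity>) f" using int by (simp add: ivl)
    have "isCont (\<lambda>x. complex_of_real (sqrt x)) 0" by (intro continuous_intros)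
    from isCont_o2[OF this DERIV_isCont[OF H_deriv]] have "((\<lambda>x. H (of_real (sqrt x))) \<longlongrightarrow> H 0) (at_right 0)"
      by (auto simp: isCont_def intro: tendsto_within_subset)
    then show "(((\<lambda>x. H (of_real (sqrt x))) \<circ> real_of_ereal) \<longlongrightarrow> H 0) (at_right 0)"
      unfolding zero_ereal_def ereal_tendsto_simps .
    have "((\<lambda>x. H (of_real (sqrt x))) \<longlongrightarrow> 0) at_top"
    proof (rule Lim_null_comparison)
      show "\<forall>\<^sub>F x in at_top. norm (H (of_real (sqrt x))) \<le>
          2 * (norm \<alpha> * exp (- \<eta> * sqrt x) + norm u * exp (- \<eta> * sqrt x)) / norm (u\<^sup>2 + \<alpha>\<^sup>2)"
        using eventually_ge_at_top[of 0]
      proof eventually_elim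
        case (elim x)
        let ?z = "complex_of_real (sqrt x)"
        define X where "X = \<alpha> * (exp (- ?z * \<alpha>) * sin (?z * u)) + u * (exp (- ?z * \<alpha>) * cos (?z * u))"
        have "norm X \<le> norm \<alpha> * exp (- \<eta> * sqrt x) + norm u * exp (- \<eta> * sqrt x)"
          unfolding X_def using decay[OF bound_sin, of "sqrt x"] decay[OF bound_cos, of "sqrt x"] elim
          by (intro norm_triangle_mono) (auto simp: norm_mult intro!: mult_left_mono)
        moreover have "H ?z = - 2 * X / (u\<^sup>2 + \<alpha>\<^sup>2)"
          by (simp add: H_def X_def algebra_simps)
        then have "norm (H ?z) = 2 * norm X / norm (u\<^sup>2 + \<alpha>\<^sup>2)"
          by (simp only: norm_mult norm_divide) simp
        ultimately show ?case by (simp only: divide_right_mono mult_left_mono norm_ge_zero zero_le_numeral)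
      qed
      have "((\<lambda>x. exp (- \<eta> * sqrt x)) \<longlongrightarrow> 0) at_top" using \<eta> by real_asymp
      then have "((\<lambda>x. 2 * (norm \<alpha> * exp (- \<eta> * sqrt x) + norm u * exp (- \<eta> * sqrt x)) / norm (u\<^sup>2 + \<alpha>\<^sup>2))
          \<longlongrightarrow> 2 * (norm \<alpha> * 0 + norm u * 0) / norm (u\<^sup>2 + \<alpha>\<^sup>2)) at_top"
        using ne by (intro tendsto_intros) auto
      then show "((\<lambda>x. 2 * (norm \<alpha> * exp (- \<eta> * sqrt x) + norm u * exp (- \<eta> * sqrt x)) / norm (u\<^sup>2 + \<alpha>\<^sup>2)) \<longlongrightarrow> 0) at_top"
        by simp
    qed
    then show "(((\<lambda>x. H (of_real (sqrt x))) \<circ> real_of_ereal) \<longlongrightarrow> 0) (at_left \<infinity>)"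
      unfolding ereal_tendsto_simps .
  qed simp
  then show "(LINT x:{0<..}|lborel. f x) = 2 * u / (u\<^sup>2 + \<alpha>\<^sup>2)"
    by (simp add: interval_lebesgue_integral_def ivl H_def)
qed

text \<open>The summand belongs to the pair of lattice points \<open>\<plusminus> ((2 j - m) K + \<i> (m + 1) K')\<close>.\<close>

definition upper_cone_sum :: "real \<Rightarrow> real \<Rightarrow> complex \<Rightarrow> nat \<Rightarrow> complex" where
  "upper_cone_sum K K' u M = (\<Sum>m<M. \<Sum>j\<le>m. 2 * (- 1) ^ m *
     (2 * u / (u\<^sup>2 + (Complex (real (m + 1) * K') ((real m - 2 * real j) * K))\<^sup>2)))"

lemma kernel_sum_eq:
  "kernel_sum K K' M z = (\<Sum>m<M. \<Sum>j\<le>m. 2 * (- 1) ^ m *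
     exp (- of_real z * Complex (real (m + 1) * K') ((real m - 2 * real j) * K)))"
  unfolding kernel_sum_def sum_distrib_left
proof (intro sum.cong refl)
  fix m j :: nat assume "j \<in> {..m}"
  then have "j \<le> m" by simp
  let ?a = "complex_of_real z * Complex (- K') K" and ?b = "complex_of_real z * Complex (- K') (- K)"
  have "(- exp ?a) ^ j * (- exp ?b) ^ (m - j) = (- 1) ^ j * (- 1) ^ (m - j) * (exp ?a ^ j * exp ?b ^ (m - j))"
    by (subst (1 2) power_minus) simp
  also have "(- 1) ^ j * (- 1) ^ (m - j) = ((- 1) ^ m :: complex)"
    using \<open>j \<le> m\<close> by (simp flip: power_add)
  finally have "2 * of_real (exp (- z * K')) * ((- exp ?a) ^ j * (- exp ?b) ^ (m - j)) =
     2 * (- 1) ^ m * (exp (of_real (- z * K')) * exp (of_nat j * ?a) * exp (of_nat (m - j) * ?b))"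
    unfolding exp_of_nat_mult exp_of_real by simp
  also have "exp (of_real (- z * K')) * exp (of_nat j * ?a) * exp (of_nat (m - j) * ?b) =
     exp (of_real (- z * K') + of_nat j * ?a + of_nat (m - j) * ?b)"
    by (simp only: exp_add)
  also have "of_real (- z * K') + of_nat j * ?a + of_nat (m - j) * ?b =
     - of_real z * Complex (real (m + 1) * K') ((real m - 2 * real j) * K)"
    using \<open>j \<le> m\<close> by (simp add: complex_eq_iff of_nat_diff algebra_simps)
  finally show "2 * of_real (exp (- z * K')) * ((- exp ?a) ^ j * (- exp ?b) ^ (m - j)) = 2 * (- 1) ^ m *
     exp (- of_real z * Complex (real (m + 1) * K') ((real m - 2 * real j) * K))" .
qed

text \<open>Dominated convergence is applied to the partial sums. Adding up the moduli of the terms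
  would give an integrand of order 1/x at 0, which is not integrable, while the partial sums have
  the common majorant exp(-\<eta> sqrt x) / sqrt x up to a constant.\<close>

lemma half_line_integral:
  fixes u :: complex
  assumes K: "0 < K" "0 < K'" and u: "\<bar>Im u\<bar> < K'"
  defines "f \<equiv> \<lambda>x. sin (of_real (sqrt x) * u) / of_real (sqrt x) *
     (1 / (cos (of_real (sqrt x) * of_real K) + cosh (of_real (sqrt x) * of_real K')))"
  shows "set_integrable lborel {0<..} f"
    and "upper_cone_sum K K' u \<longlonglongrightarrow> (LINT x:{0<..}|lborel. f x)"
proof -
  define \<alpha> where "\<alpha> m j = Complex (real (m + 1) * K') ((real m - 2 * real j) * K)" for m j :: nat
  define e where "e m j x = indicator {0<..} x *\<^sub>R
     (sin (of_real (sqrt x) * u) / of_real (sqrt x) * exp (- of_real (sqrt x) * \<alpha> m j))" for m j x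
  define g where "g M x = indicator {0<..} x *\<^sub>R
     (sin (of_real (sqrt x) * u) / of_real (sqrt x) * kernel_sum K K' M (sqrt x))" for M x
  define \<eta> where "\<eta> = K' - \<bar>Im u\<bar>"
  have \<eta>: "0 < \<eta>" using u by (simp add: \<eta>_def)
  have Re: "\<bar>Im u\<bar> < Re (\<alpha> m j)" for m j
  proof -
    have "1 * K' \<le> real (m + 1) * K'" using K by (intro mult_right_mono) auto
    then show ?thesis using u by (simp add: \<alpha>_def)
  qed
  have e: "integrable lborel (e m j)" "integral\<^sup>L lborel (e m j) = 2 * u / (u\<^sup>2 + (\<alpha> m j)\<^sup>2)" for m j
    using sin_exp_integral[OF Re, of m j] by (simp_all add: set_integrable_def set_lebesgue_integral_def e_def[abs_def])
  have g_eq: "g M x = (\<Sum>m<M. \<Sum>j\<le>m. 2 * (- 1) ^ m * e m j x)" for M x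
    by (simp add: g_def kernel_sum_eq e_def \<alpha>_def sum_distrib_left scaleR_sum_right mult_ac)
  have g_int: "integral\<^sup>L lborel (g M) = upper_cone_sum K K' u M" for M
    unfolding g_eq[abs_def] upper_cone_sum_def \<alpha>_def[symmetric]
    by (simp add: Bochner_Integration.integral_sum integrable_sum e)
  have g_meas: "g M \<in> borel_measurable lborel" for M
    unfolding g_eq[abs_def] using e(1) by (auto intro!: borel_measurable_sum)
  obtain B where "0 \<le> B" and
    B: "\<And>M z. 0 < z \<Longrightarrow> norm (kernel_sum K K' M z) \<le> B * exp (- z * K') * (1 + 1 / z)"
    using kernel_sum_bound[OF K] by blast
  have w: "integrable lborel (\<lambda>x. indicator {0<..} x *\<^sub>R (B * (1 + norm u) * (exp (- \<eta> * sqrt x) / sqrt x)))"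
    using integrable_mult_right[OF integrable_exp_sqrt[OF \<eta>, unfolded set_integrable_def], of "B * (1 + norm u)"]
    by (simp add: mult_ac)
  have bound: "norm (g M x) \<le> indicator {0<..} x *\<^sub>R (B * (1 + norm u) * (exp (- \<eta> * sqrt x) / sqrt x))" for M x
  proof (cases "0 < x")
    case True
    define z where "z = sqrt x"
    have "0 < z" using True by (simp add: z_def)
    have Im: "\<bar>Im (of_real z * u)\<bar> = z * \<bar>Im u\<bar>" using \<open>0 < z\<close> by (simp add: abs_mult)
    have s1: "norm (sin (of_real z * u)) \<le> exp (z * \<bar>Im u\<bar>)"
      using cmod_sin_le_exp[of 1 "of_real z * u"] Im by simp
    have s2: "norm (sin (of_real z * u)) \<le> z * norm u * exp (z * \<bar>Im u\<bar>)"
      using norm_sin_le_mult_exp[of "of_real z * u"] \<open>0 < z\<close> Im by (simp add: norm_mult)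
    \<comment> \<open>The summand 1 is paired with the exponential bound for the sine, the summand
      1/z with the bound that carries the extra factor z.\<close>
    have "norm (sin (of_real z * u)) * (1 + 1 / z) \<le> exp (z * \<bar>Im u\<bar>) + norm u * exp (z * \<bar>Im u\<bar>)"
    proof -
      have "norm (sin (of_real z * u)) * (1 / z) \<le> z * norm u * exp (z * \<bar>Im u\<bar>) * (1 / z)"
        using \<open>0 < z\<close> by (intro mult_right_mono s2) auto
      with s1 \<open>0 < z\<close> show ?thesis by (simp add: distrib_left)
    qed
    also have "\<dots> = (1 + norm u) * exp (z * \<bar>Im u\<bar>)" by (simp add: algebra_simps)
    finally have s: "norm (sin (of_real z * u)) * (1 + 1 / z) \<le> (1 + norm u) * exp (z * \<bar>Im u\<bar>)" .
    have "norm (g M x) = norm (sin (of_real z * u)) * norm (kernel_sum K K' M z) / z"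
      using True \<open>0 < z\<close> by (simp add: g_def z_def[symmetric] norm_mult norm_divide)
    also have "\<dots> \<le> norm (sin (of_real z * u)) * (B * exp (- z * K') * (1 + 1 / z)) / z"
      using \<open>0 < z\<close> by (intro divide_right_mono mult_left_mono B) auto
    also have "\<dots> = B * exp (- z * K') * (norm (sin (of_real z * u)) * (1 + 1 / z)) / z"
      by (simp only: mult_ac)
    also have "\<dots> \<le> B * exp (- z * K') * ((1 + norm u) * exp (z * \<bar>Im u\<bar>)) / z"
      using \<open>0 < z\<close> \<open>0 \<le> B\<close> by (intro divide_right_mono mult_left_mono s) auto
    also have "\<dots> = B * (1 + norm u) * (exp (- \<eta> * z) / z)"
      by (simp add: \<eta>_def algebra_simps flip: exp_add)
    finally show ?thesis using True by (simp add: z_def)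
  qed (simp add: g_def)
  have lim: "(\<lambda>M. g M x) \<longlonglongrightarrow> indicator {0<..} x *\<^sub>R f x" for x
  proof (cases "0 < x")
    case True
    then have "(\<lambda>M. kernel_sum K K' M (sqrt x)) \<longlonglongrightarrow>
        1 / (cos (of_real (sqrt x * K)) + cosh (of_real (sqrt x * K')))"
      by (intro kernel_sum_tendsto K) simp
    then show ?thesis unfolding g_def f_def of_real_mult by (intro tendsto_intros)
  qed (simp add: g_def)
  have meas: "(\<lambda>x. indicator {0<..} x *\<^sub>R f x) \<in> borel_measurable lborel"
    by (rule borel_measurable_LIMSEQ_metric[OF g_meas lim])
  show "set_integrable lborel {0<..} f"
    unfolding set_integrable_def
    by (rule integrable_dominated_convergence[OF meas g_meas w AE_I2[OF lim] AE_I2[OF bound]])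
  have "(\<lambda>M. integral\<^sup>L lborel (g M)) \<longlonglongrightarrow> integral\<^sup>L lborel (\<lambda>x. indicator {0<..} x *\<^sub>R f x)"
    by (rule integral_dominated_convergence[OF meas g_meas w AE_I2[OF lim] AE_I2[OF bound]])
  then show "upper_cone_sum K K' u \<longlonglongrightarrow> (LINT x:{0<..}|lborel. f x)"
    unfolding g_int set_lebesgue_integral_def .
qed

lemma whole_line_integral:
  fixes u :: complex
  assumes K: "0 < K" "0 < K'" and u: "\<bar>Re u\<bar> < K" "\<bar>Im u\<bar> < K'"
  defines "f \<equiv> \<lambda>x :: real. sin_sqrt_quot u x *
             (1 / (cos (csqrt (of_real x) * of_real K) + cosh (csqrt (of_real x) * of_real K')))"
  shows "integrable lborel f"
    and "(\<lambda>M. upper_cone_sum K K' u M - \<i> * upper_cone_sum K' K (\<i> * u) M) \<longlonglongrightarrow> (LINT x|lborel. f x)"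
proof -
  define g where "g L L' v x = sin (of_real (sqrt x) * v) / of_real (sqrt x) *
     (1 / (cos (of_real (sqrt x) * of_real L) + cosh (of_real (sqrt x) * of_real L')))" for L L' x :: real and v :: complex
  have pos: "f x = g K K' u x" if "0 < x" for x
    using that by (simp add: f_def g_def sin_sqrt_quot_def csqrt_of_real_nonneg)
  \<comment> \<open>For negative x the root is i sqrt(-x). This interchanges cos and cosh, hence K
    and K', and the root in the denominator leaves the factor -i.\<close>
  have neg: "f x = - \<i> * g K' K (\<i> * u) (- x)" if "x < 0" for x
  proof -
    have c: "csqrt (of_real x) = \<i> * of_real (sqrt (- x))"
      using that by (simp add: csqrt_of_real_nonpos)
    have 1: "cos (\<i> * of_real (sqrt (- x)) * of_real K) = cosh (of_real (sqrt (- x)) * of_real K)"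
      and 2: "cosh (\<i> * of_real (sqrt (- x)) * of_real K') = cos (of_real (sqrt (- x)) * of_real K')"
      by (simp_all add: cos_exp_eq cosh_def scaleR_conv_of_real mult.assoc flip: exp_minus)
    have 3: "\<i> * of_real (sqrt (- x)) * u = of_real (sqrt (- x)) * (\<i> * u)" by simp
    have 4: "a / (\<i> * b) = - \<i> * (a / b)" for a b :: complex
      by (cases "b = 0") (auto simp: field_simps)
    show ?thesis using that unfolding f_def sin_sqrt_quot_def c 1 2 3 4 g_def
      by (simp add: add.commute)
  qed
  have K': "\<bar>Im (\<i> * u)\<bar> < K" using u by simp
  note 1 = half_line_integral[OF K u(2), folded g_def]
  note 2 = half_line_integral[OF K(2) K(1) K', folded g_def]
  define f\<^sub>1 where "f\<^sub>1 x = indicator {0<..} x *\<^sub>R g K K' u x" for x :: real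
  define f\<^sub>2 where "f\<^sub>2 x = indicator {0<..} x *\<^sub>R g K' K (\<i> * u) x" for x :: real
  have f\<^sub>1: "integrable lborel f\<^sub>1" "upper_cone_sum K K' u \<longlonglongrightarrow> integral\<^sup>L lborel f\<^sub>1"
    using 1 by (simp_all add: f\<^sub>1_def[abs_def] set_integrable_def set_lebesgue_integral_def)
  have f\<^sub>2: "integrable lborel f\<^sub>2" "upper_cone_sum K' K (\<i> * u) \<longlonglongrightarrow> integral\<^sup>L lborel f\<^sub>2"
    using 2 by (simp_all add: f\<^sub>2_def[abs_def] set_integrable_def set_lebesgue_integral_def)
  have refl: "integrable lborel (\<lambda>x. f\<^sub>2 (- x))" "(LINT x|lborel. f\<^sub>2 (- x)) = integral\<^sup>L lborel f\<^sub>2"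
    using lborel_integrable_real_affine[OF f\<^sub>2(1), of "- 1" 0] lborel_integral_real_affine[of "- 1" f\<^sub>2 0] by simp_all
  have split: "f\<^sub>1 x - \<i> * f\<^sub>2 (- x) = f x" if "x \<noteq> 0" for x
    using that pos[of x] neg[of x] by (cases "0 < x") (auto simp: f\<^sub>1_def f\<^sub>2_def)
  have int: "has_bochner_integral lborel (\<lambda>x. f\<^sub>1 x - \<i> * f\<^sub>2 (- x)) (integral\<^sup>L lborel f\<^sub>1 - \<i> * integral\<^sup>L lborel f\<^sub>2)"
    unfolding refl(2)[symmetric] using f\<^sub>1(1) refl(1)
    by (intro has_bochner_integral_diff has_bochner_integral_mult_right has_bochner_integral_integrable)
  \<comment> \<open>At x = 0 the two sides may differ, since both half-line pieces vanish there; a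
    single point does not affect the integral.\<close>
  have "has_bochner_integral lborel f (integral\<^sup>L lborel f\<^sub>1 - \<i> * integral\<^sup>L lborel f\<^sub>2)"
    using int by (subst (asm) has_bochner_integral_discrete_difference[where X = "{0}" and g = f]) (auto simp: split)
  then show "integrable lborel f"
    and "(\<lambda>M. upper_cone_sum K K' u M - \<i> * upper_cone_sum K' K (\<i> * u) M) \<longlonglongrightarrow> (LINT x|lborel. f x)"
    using tendsto_diff[OF f\<^sub>1(2) tendsto_mult_left[OF f\<^sub>2(2), of \<i>]]
    by (auto simp: has_bochner_integral_iff)
qed

section \<open>Comparison of the two sums\<close>

definition upper_cone :: "nat \<Rightarrow> (int \<times> int) set" where
  "upper_cone N = {(n, m). \<bar>n\<bar> < m \<and> m \<le> int N \<and> odd (n + m)}"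

lemma finite_upper_cone: "finite (upper_cone N)"
  by (rule finite_subset[OF _ finite_odd_square[of N]]) (auto simp: upper_cone_def odd_square_def)

text \<open>The row at height m + 1 consists of the m + 1 integers n with |n| \<le> m and the parity
  of m, that is n = 2 j - m for j from 0 to m. Heights start at 1 and degrees at 0, whence the
  shift.\<close>

lemma sum_upper_cone:
  fixes T :: "int \<times> int \<Rightarrow> complex"
  shows "(\<Sum>p\<in>upper_cone N. T p) = (\<Sum>m<N. \<Sum>j\<le>m. T (2 * int j - int m, int m + 1))"
proof -
  have "(\<Sum>m<N. \<Sum>j\<le>m. T (2 * int j - int m, int m + 1)) =
      (\<Sum>(m, j)\<in>Sigma {..<N} (\<lambda>m. {..m}). T (2 * int j - int m, int m + 1))"
    by (rule sum.Sigma) auto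
  also have "\<dots> = (\<Sum>p\<in>upper_cone N. T p)"
  proof (rule sum.reindex_bij_witness[where
      i = "\<lambda>(n, m). (nat (m - 1), nat ((n + m - 1) div 2))" and
      j = "\<lambda>(m, j). (2 * int j - int m, int m + 1)"])
    fix p assume "p \<in> upper_cone N"
    then obtain n m where p: "p = (n, m)" "\<bar>n\<bar> < m" "m \<le> int N" "odd (n + m)"
      by (auto simp: upper_cone_def)
    then obtain i where "n + m = 2 * i + 1" using oddE by blast
    with p show "(case case p of (n, m) \<Rightarrow> (nat (m - 1), nat ((n + m - 1) div 2)) of
        (m, j) \<Rightarrow> (2 * int j - int m, int m + 1)) = p"
      and "(case p of (n, m) \<Rightarrow> (nat (m - 1), nat ((n + m - 1) div 2))) \<in> Sigma {..<N} (\<lambda>m. {..m})"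
      by (auto simp: nat_less_iff)
  qed (auto simp: upper_cone_def)
  finally show ?thesis ..
qed

text \<open>A point of the odd square has \<open>\<bar>n\<bar> \<noteq> \<bar>m\<bar>\<close>, so the square is the disjoint union of
  the four rotations of the upper cone.\<close>

lemma sum_odd_square:
  fixes T :: "int \<times> int \<Rightarrow> complex"
  assumes even: "\<And>n m. T (- n, - m) = T (n, m)"
  shows "(\<Sum>p\<in>odd_square N. T p) = 2 * (\<Sum>(n, m)\<in>upper_cone N. T (n, m)) + 2 * (\<Sum>(n, m)\<in>upper_cone N. T (m, - n))"
proof -
  define r :: "nat \<Rightarrow> int \<times> int \<Rightarrow> int \<times> int" where "r i = (\<lambda>(n, m). if i = 0 then (n, m) else if i = 1 then (- n, - m)
      else if i = 2 then (m, - n) else (- m, n))" for i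
  have "odd_square N = (\<Union>i\<in>{0, 1, 2, 3}. r i ` upper_cone N)"
  proof (intro set_eqI iffI)
    fix p assume "p \<in> odd_square N"
    then obtain n m where p: "p = (n, m)" "\<bar>n\<bar> \<le> int N" "\<bar>m\<bar> \<le> int N" "odd (n + m)"
      by (auto simp: odd_square_def)
    then have "\<bar>n\<bar> \<noteq> \<bar>m\<bar>" by (auto simp: abs_if split: if_splits)
    then consider "\<bar>n\<bar> < m" | "\<bar>n\<bar> < - m" | "\<bar>m\<bar> < n" | "\<bar>m\<bar> < - n" by linarith
    then show "p \<in> (\<Union>i\<in>{0, 1, 2, 3}. r i ` upper_cone N)"
    proof cases
      case 1
      then have "p \<in> r 0 ` upper_cone N" using p by (intro image_eqI[of _ _ "(n, m)"]) (auto simp: r_def upper_cone_def)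
      then show ?thesis by blast
    next
      case 2
      then have "p \<in> r 1 ` upper_cone N" using p by (intro image_eqI[of _ _ "(- n, - m)"]) (auto simp: r_def upper_cone_def)
      then show ?thesis by blast
    next
      case 3
      then have "p \<in> r 2 ` upper_cone N" using p by (intro image_eqI[of _ _ "(- m, n)"]) (auto simp: r_def upper_cone_def)
      then show ?thesis by blast
    next
      case 4
      then have "p \<in> r 3 ` upper_cone N" using p by (intro image_eqI[of _ _ "(m, - n)"]) (auto simp: r_def upper_cone_def)
      then show ?thesis by blast
    qed
  qed (auto simp: r_def upper_cone_def odd_square_def)
  also have "(\<Sum>p\<in>(\<Union>i\<in>{0, 1, 2, 3}. r i ` upper_cone N). T p) = (\<Sum>i\<in>{0, 1, 2, 3}. \<Sum>p\<in>r i ` upper_cone N. T p)"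
  proof (rule sum.UNION_disjoint)
    show "\<forall>i\<in>{0, 1, 2, 3}. finite (r i ` upper_cone N)" using finite_upper_cone by simp
  qed (auto simp: r_def upper_cone_def)
  also have "\<dots> = (\<Sum>i\<in>{0, 1, 2, 3}. \<Sum>p\<in>upper_cone N. T (r i p))"
    by (intro sum.cong refl sum.reindex_cong[of "r _"]) (auto simp: inj_on_def r_def)
  also have "\<dots> = 2 * (\<Sum>(n, m)\<in>upper_cone N. T (n, m)) + 2 * (\<Sum>(n, m)\<in>upper_cone N. T (m, - n))"
    using even[of "- m" n for m n] by (simp add: r_def case_prod_unfold even)
  finally show ?thesis .
qed

context jacobi_pair
begin

text \<open>For a lattice point p = i \<alpha> one has u^2 + \<alpha>^2 = u^2 - p^2, which
  identifies the vertical part. In the horizontal part - i (i u) = u, and the sign from (i u)^2 +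
  c^2 = - (u^2 - c^2) matches that of \<open>\<rho>\<close>. Each cone carries the weight 4, while
  the square contains each cone together with its negative, so the total is twice the sum over the
  square.\<close>

lemma upper_cone_sums_eq:
  "(upper_cone_sum K K' u N - \<i> * upper_cone_sum K' K (\<i> * u) N) / 2 =
     (\<Sum>p\<in>odd_square N. \<rho> p * (u / (u\<^sup>2 - (lattice_point K K' p)\<^sup>2)))"
proof -
  define T where "T p = \<rho> p * (u / (u\<^sup>2 - (lattice_point K K' p)\<^sup>2))" for p
  have minus: "T (- n, - m) = T (n, m)" for n m
  proof -
    have "lattice_point K K' (- n, - m) = - lattice_point K K' (n, m)"
      by (simp add: lattice_point_def complex_eq_iff)
    then show ?thesis by (simp add: T_def \<rho>_def)
  qed
  have upper: "2 * (- 1) ^ m * (2 * u / (u\<^sup>2 + (Complex (real (m + 1) * K') ((real m - 2 * real j) * K))\<^sup>2)) =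
      4 * T (2 * int j - int m, int m + 1)" for m j
  proof -
    have "lattice_point K K' (2 * int j - int m, int m + 1) = \<i> * Complex (real (m + 1) * K') ((real m - 2 * real j) * K)"
      by (simp add: lattice_point_def complex_eq_iff algebra_simps)
    moreover have "\<rho> (2 * int j - int m, int m + 1) = (- 1) ^ m" by (simp add: \<rho>_def)
    ultimately show ?thesis by (simp add: T_def power_mult_distrib)
  qed
  have right: "- \<i> * (2 * (- 1) ^ m * (2 * (\<i> * u) / ((\<i> * u)\<^sup>2 + (Complex (real (m + 1) * K) ((real m - 2 * real j) * K'))\<^sup>2))) =
      4 * T (int m + 1, - (2 * int j - int m))" for m j
  proof -
    define c where "c = Complex (real (m + 1) * K) ((real m - 2 * real j) * K')"
    have "lattice_point K K' (int m + 1, - (2 * int j - int m)) = c"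
      by (simp add: lattice_point_def c_def complex_eq_iff algebra_simps)
    moreover have "\<rho> (int m + 1, - (2 * int j - int m)) = - ((- 1) ^ m)" by (simp add: \<rho>_def)
    ultimately have "4 * T (int m + 1, - (2 * int j - int m)) = 4 * (- 1) ^ m * (u / - (u\<^sup>2 - c\<^sup>2))"
      unfolding divide_minus_right by (simp add: T_def)
    also have "- (u\<^sup>2 - c\<^sup>2) = (\<i> * u)\<^sup>2 + c\<^sup>2" by (simp add: power_mult_distrib)
    finally have *: "4 * T (int m + 1, - (2 * int j - int m)) = 4 * (- 1) ^ m * (u / ((\<i> * u)\<^sup>2 + c\<^sup>2))" .
    have "- \<i> * (2 * x * (2 * (\<i> * u) / y)) = 4 * x * (u / y)" for x y
      by (cases "y = 0") (simp_all add: field_simps)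
    then show ?thesis unfolding c_def[symmetric] * .
  qed
  have "upper_cone_sum K K' u N = 4 * (\<Sum>p\<in>upper_cone N. T p)"
    unfolding upper_cone_sum_def upper sum_upper_cone by (simp add: sum_distrib_left)
  moreover have "- \<i> * upper_cone_sum K' K (\<i> * u) N = 4 * (\<Sum>(n, m)\<in>upper_cone N. T (m, - n))"
    unfolding upper_cone_sum_def sum_distrib_left[of "- \<i>"] right sum_upper_cone by (simp add: sum_distrib_left)
  ultimately have "upper_cone_sum K K' u N - \<i> * upper_cone_sum K' K (\<i> * u) N =
      2 * (\<Sum>p\<in>odd_square N. T p)"
    unfolding sum_odd_square[of T, OF minus] by (simp add: case_prod_unfold)
  then show ?thesis by (simp add: T_def)
qed

text \<open>At u = 0 the two kernel poles u and -u coincide and the residue argument breaks down;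
  there every summand and \<open>G\<close> itself are 0.\<close>

lemma G_eq_limit:
  assumes "\<bar>Re u\<bar> < K" "\<bar>Im u\<bar> < K'"
  shows "(\<lambda>N. (upper_cone_sum K K' u N - \<i> * upper_cone_sum K' K (\<i> * u) N) / 2) \<longlonglongrightarrow> G u"
proof (cases "u = 0")
  case True
  then show ?thesis unfolding upper_cone_sums_eq by (simp add: G_def at_0)
next
  case False
  then show ?thesis unfolding upper_cone_sums_eq using square_sums_tendsto assms by blast
qed

end

theorem theorem1:
  fixes k k' K K' :: real and u :: complex
  assumes "0 < k" and "k < 1"
    and "k' = sqrt (1 - k\<^sup>2)"
    and "K = elliptic_K k" and "K' = elliptic_K k'"
    and "\<bar>Re u\<bar> < K" and "\<bar>Im u\<bar> < K'"
  defines "f \<equiv> \<lambda>x :: real. sin_sqrt_quot u x *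
             (1 / (cos (csqrt (of_real x) * of_real K) + cosh (csqrt (of_real x) * of_real K')))"
  shows "integrable lborel f \<and>
         1 / 2 * (LINT x|lborel. f x) = jacobi_sn u k / jacobi_cd u k"
proof -
  have k2: "k\<^sup>2 < 1" "0 < k\<^sup>2" using assms(1,2) by (simp_all add: power_less_one_iff)
  then have k': "0 < k'" "k' < 1" "k'\<^sup>2 = 1 - k\<^sup>2" by (simp_all add: assms(3))
  obtain s c d where jac: "real_jacobi k K s c d"
    using real_jacobi_exists[OF assms(1,2)] assms(4) by blast
  obtain s' c' d' where jac': "real_jacobi k' K' s' c' d'"
    using real_jacobi_exists[OF k'(1,2)] assms(5) by blast
  interpret jacobi_pair k k' K K' s c d s' c' d'
    by unfold_locales (fact jac jac' k'(3))+
  note f = whole_line_integral[OF K_pos assms(6,7), folded f_def]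
  \<comment> \<open>The rearrangement a / (b / c) = a c / b needs no side condition, as both sides
    are 0 when b or c is 0.\<close>
  have "jacobi_sn u k / jacobi_cd u k = G u"
    by (simp add: jacobi_sn_def jacobi_cd_def jacobi_cn_def jacobi_dn_def jacobi_triple_eq G_def)
  moreover have "(LINT x|lborel. f x) / 2 = G u"
  proof (rule LIMSEQ_unique[OF _ G_eq_limit[OF assms(6,7)]])
    show "(\<lambda>N. (upper_cone_sum K K' u N - \<i> * upper_cone_sum K' K (\<i> * u) N) / 2) \<longlonglongrightarrow> (LINT x|lborel. f x) / 2"
      by (intro tendsto_divide f(2) tendsto_const) simp
  qed
  ultimately show ?thesis using f(1) by simp
qed

end
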